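(* Let $a>0$, $R>0$, let $V\in C^2([0,\infty))$ be real-valued, and let $V_{\min},V_{\max},|V'|_{\max},V''_{\min},V''_{\max}$ be real constants such that for all $x\in[0,\infty)$ $$V_{\min}\le V(x)\le V_{\max},\qquad |V'(x)|\le |V'|_{\max},\qquad V''_{\min}\le V''(x)\le V''_{\max}.$$ Let $D(A)=H^4(0,\infty)\cap H_0^2(0,\infty)$ (complex-valued functions), $X=H^2(0,\infty)\cap H^1_0(0,\infty)$, and define $A:D(A)\to L^2(0,\infty)$ and $B:X\to L^2(0,\infty)$ by $$Au=(-D^2+a^2)^2u+iaR\,[V\cdot(-D^2+a^2)u+V''\cdot u],\qquad Bu=(-D^2+a^2)u,\qquad D=\tfrac{d}{dx}.$$ If $V''\le 0$ on $[0,\infty)$, then every eigenvalue $\lambda$ of the problem $Au=\lambda Bu$ is contained in the set $$[a^2,\infty)+iaR\,[V_{\min},V_{\max}]+\tfrac{R}{2}|V'|_{\max}\cdot\Delta^-,$$ where $\Delta^-:=\{z\in\Delta:\operatorname{Im} z\le 0\}$ and $\Delta$ denotes the closed unit disc in $\mathbb{C}$.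
   Context: An eigenvalue of the problem $Au=\lambda Bu$ is a number $\lambda\in\mathbb{C}$ for which there exists $u\in D(A)$, $u\ne 0$, with $Au=\lambda Bu$. $H^1_0(0,\infty)$ and $H_0^2(0,\infty)$ are the usual Sobolev spaces with vanishing traces at $0$ ($u(0)=0$, respectively $u(0)=u'(0)=0$), and $i$ is the imaginary unit. Sums and products of sets (and of numbers with sets) are elementwise: $S+T=\{s+t: s\in S,\ t\in T\}$, $cS=\{cs: s\in S\}$. *)

theory Defs
  imports "HOL-Analysis.Analysis" "HOL-Library.Set_Algebras"
begin

(* An element of L^2(0,\<infinity>) is represented by a function real \<Rightarrow> complex, considered up to
   equality almost everywhere on (0,\<infinity>); values outside (0,\<infinity>) are irrelevant. *)

abbreviation half_line :: "real measure" where
  "half_line \<equiv> lebesgue_on {0<..}"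

definition L2 :: "(real \<Rightarrow> complex) set" where
  "L2 = {u. u \<in> borel_measurable half_line \<and> integrable half_line (\<lambda>x. (cmod (u x))\<^sup>2)}"

definition locally_integrable :: "(real \<Rightarrow> complex) \<Rightarrow> bool" where
  "locally_integrable u \<longleftrightarrow> (\<forall>a>0. \<forall>b. integrable (lebesgue_on {a..b}) u)"

(* Real-valued test functions C_c^\<infinity>(0,\<infinity>); by linearity they determine the same weak
   derivatives as the complex-valued ones. *)
definition test_function :: "(real \<Rightarrow> real) \<Rightarrow> bool" where
  "test_function \<phi> \<longleftrightarrow>
     (\<forall>k. (deriv ^^ k) \<phi> differentiable_on UNIV) \<and>
     (\<exists>a>0. \<exists>b. \<forall>x. x \<notin> {a..b} \<longrightarrow> \<phi> x = 0)"

definition has_weak_deriv :: "nat \<Rightarrow> (real \<Rightarrow> complex) \<Rightarrow> (real \<Rightarrow> complex) \<Rightarrow> bool" where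
  "has_weak_deriv k u g \<longleftrightarrow>
     locally_integrable u \<and> locally_integrable g \<and>
     (\<forall>\<phi>. test_function \<phi> \<longrightarrow>
        (LINT x|half_line. (deriv ^^ k) \<phi> x *\<^sub>R u x) =
        (-1) ^ k * (LINT x|half_line. \<phi> x *\<^sub>R g x))"

(* The k-th weak derivative is unique only up to null sets; this selects a representative. *)
definition weak_deriv :: "nat \<Rightarrow> (real \<Rightarrow> complex) \<Rightarrow> real \<Rightarrow> complex" where
  "weak_deriv k u = (SOME g. has_weak_deriv k u g)"

definition H :: "nat \<Rightarrow> (real \<Rightarrow> complex) set" where
  "H m = {u \<in> L2. \<forall>k\<in>{1..m}. \<exists>g\<in>L2. has_weak_deriv k u g}"

(* The trace of u at 0 is the value at 0 of the representative that is continuous up to 0. *)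
definition vanishing_trace :: "(real \<Rightarrow> complex) \<Rightarrow> bool" where
  "vanishing_trace u \<longleftrightarrow>
     (\<exists>v. continuous_on {0..} v \<and> (AE x in half_line. v x = u x) \<and> v 0 = 0)"

definition H10 :: "(real \<Rightarrow> complex) set" where
  "H10 = {u \<in> H 1. vanishing_trace u}"

definition H20 :: "(real \<Rightarrow> complex) set" where
  "H20 = {u \<in> H 2. vanishing_trace u \<and> vanishing_trace (weak_deriv 1 u)}"

definition domA :: "(real \<Rightarrow> complex) set" where
  "domA = H 4 \<inter> H20"

definition domB :: "(real \<Rightarrow> complex) set" where
  "domB = H 2 \<inter> H10"

definition opB :: "real \<Rightarrow> (real \<Rightarrow> complex) \<Rightarrow> real \<Rightarrow> complex" where
  "opB a u = (\<lambda>x. - weak_deriv 2 u x + (complex_of_real a)\<^sup>2 * u x)"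

(* V'' is passed as a separate argument. *)
definition opA :: "real \<Rightarrow> real \<Rightarrow> (real \<Rightarrow> real) \<Rightarrow> (real \<Rightarrow> real) \<Rightarrow>
    (real \<Rightarrow> complex) \<Rightarrow> real \<Rightarrow> complex" where
  "opA a R V V'' u = (\<lambda>x. opB a (opB a u) x +
     \<i> * complex_of_real (a * R) *
       (complex_of_real (V x) * opB a u x + complex_of_real (V'' x) * u x))"

definition pencil_eigenvalue ::
  "(real \<Rightarrow> complex) set \<Rightarrow> ((real \<Rightarrow> complex) \<Rightarrow> real \<Rightarrow> complex) \<Rightarrow>
   ((real \<Rightarrow> complex) \<Rightarrow> real \<Rightarrow> complex) \<Rightarrow> complex \<Rightarrow> bool" where
  "pencil_eigenvalue D A B l \<longleftrightarrow>
     (\<exists>u\<in>D. \<not> (AE x in half_line. u x = 0) \<and> (AE x in half_line. A u x = l * B u x))"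

lemma domA_subset_domB: "domA \<subseteq> domB"
  by (auto simp: domA_def domB_def H10_def H20_def H_def)

definition Delta :: "complex set" where
  "Delta = cball 0 1"

definition Delta_minus :: "complex set" where
  "Delta_minus = {z \<in> Delta. Im z \<le> 0}"

end

(* Every eigenfunction is a classical C^4 solution of the ODE on (0,\<infinity>): by du Bois-Reymond all
   weak derivatives up to order 3 have continuous representatives, and the equation itself then
   makes the fourth one continuous.  Put w = Bu, n = |u'|^2 + a^2|u|^2 (L^2 norms) and
   J = \<integral> V' u' cnj u.  Pairing the equation with u and integrating by parts gives
     \<lambda> n = |w|^2 + iaR [\<integral> V(|u'|^2 + a^2|u|^2) + J + \<integral> V''|u|^2],
   and n = <w,u> yields |w|^2 \<ge> a^2 n.  Since V'|u|^2 vanishes at both ends, 2 Re J = - \<integral> V''|u|^2, so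
   the last two terms add up to - cnj J; this has modulus at most V'absmax n/(2a), and real part
   of the sign of V'', which puts the remainder iaR(- cnj J)/n into the lower half of the disc. *)

theory Submission
  imports Defs
begin

section \<open>Smooth functions and a flat function\<close>

definition smooth :: "(real \<Rightarrow> real) \<Rightarrow> bool" where
  "smooth f \<longleftrightarrow> (\<forall>k. (deriv ^^ k) f differentiable_on UNIV)"

lemma deriv_funpow_in:
  assumes "f \<in> S" "\<And>f. f \<in> S \<Longrightarrow> deriv f \<in> S"
  shows "(deriv ^^ k) f \<in> S"
  using assms by (induction k) auto

lemma smooth_coinduct:
  assumes "f \<in> S" and "\<And>f. f \<in> S \<Longrightarrow> \<exists>f'\<in>S. \<forall>x. (f has_real_derivative f' x) (at x)"
  shows "smooth f"
proof -
  have d: "deriv f \<in> S" if "f \<in> S" for f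
  proof -
    from assms(2)[OF that] obtain f' where f': "f' \<in> S" "\<And>x. (f has_real_derivative f' x) (at x)" by blast
    then have "deriv f = f'" by (auto simp: DERIV_imp_deriv)
    with f' show ?thesis by simp
  qed
  have "(deriv ^^ k) f \<in> S" for k
    by (rule deriv_funpow_in) (use assms d in auto)
  then show ?thesis
    unfolding smooth_def differentiable_on_def
    by (meson assms(2) has_field_derivative_imp_has_derivative differentiable_def)
qed

lemma smooth_deriv: "smooth f \<Longrightarrow> smooth (deriv f)"
  unfolding smooth_def by (metis funpow_Suc_right o_apply)

lemma smooth_has_deriv: "smooth f \<Longrightarrow> (f has_real_derivative deriv f x) (at x)"
  unfolding smooth_def
  by (metis DERIV_deriv_iff_real_differentiable UNIV_I differentiable_on_def eq_id_iff funpow_0)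

lemma smooth_mult:
  assumes "smooth f" "smooth g"
  shows "smooth (\<lambda>x. f x * g x)"
proof (rule smooth_coinduct)
  let ?S = "{\<lambda>x. sum_list (map (\<lambda>(f, g). f x * g x) L) |L. \<forall>(f, g)\<in>set L. smooth f \<and> smooth g}"
  show "(\<lambda>x. f x * g x) \<in> ?S"
    using assms by (intro CollectI exI[of _ "[(f, g)]"]) auto
  fix h assume "h \<in> ?S"
  then obtain L where h: "h = (\<lambda>x. sum_list (map (\<lambda>(f, g). f x * g x) L))"
    and L: "\<forall>(f, g)\<in>set L. smooth f \<and> smooth g" by blast
  define L' where "L' = concat (map (\<lambda>(f, g). [(deriv f, g), (f, deriv g)]) L)"
  have L': "\<forall>(f, g)\<in>set L'. smooth f \<and> smooth g"
    using L by (auto simp: L'_def smooth_deriv)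
  have "((\<lambda>x. sum_list (map (\<lambda>(f, g). f x * g x) L)) has_real_derivative
      sum_list (map (\<lambda>(f, g). f x * g x) L')) (at x)" for x
    using L unfolding L'_def
  proof (induction L)
    case Nil then show ?case by simp
  next
    case (Cons p L)
    obtain f g where p: "p = (f, g)" by force
    have "smooth f" "smooth g" using Cons.prems p by auto
    then have "((\<lambda>x. f x * g x) has_real_derivative deriv f x * g x + f x * deriv g x) (at x)"
      by (auto intro!: derivative_eq_intros smooth_has_deriv simp: algebra_simps)
    from DERIV_add[OF this Cons.IH] show ?case using Cons.prems p by (simp add: algebra_simps)
  qed
  with L' h show "\<exists>f'\<in>?S. \<forall>x. (h has_real_derivative f' x) (at x)"
    by (intro bexI[of _ "\<lambda>x. sum_list (map (\<lambda>(f, g). f x * g x) L')"]) auto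
qed

lemma smooth_affine:
  assumes "smooth f"
  shows "smooth (\<lambda>x. f (c * x + d))"
proof (rule smooth_coinduct)
  let ?S = "{\<lambda>x. k * f (c * x + d) |k f. smooth f}"
  show "(\<lambda>x. f (c * x + d)) \<in> ?S"
    using assms by (intro CollectI exI[of _ 1] exI[of _ f]) auto
  fix h assume "h \<in> ?S"
  then obtain k f where h: "h = (\<lambda>x. k * f (c * x + d))" and f: "smooth f" by blast
  have "(h has_real_derivative (k * c) * deriv f (c * x + d)) (at x)" for x
    unfolding h
    by (rule derivative_eq_intros refl DERIV_chain2[OF smooth_has_deriv[OF f]])+ simp
  then show "\<exists>f'\<in>?S. \<forall>x. (h has_real_derivative f' x) (at x)"
    using smooth_deriv[OF f] by (intro bexI[of _ "\<lambda>x. (k * c) * deriv f (c * x + d)"]) auto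
qed

lemma smooth_lincomb:
  assumes "smooth f" "smooth g"
  shows "smooth (\<lambda>x. f x - c * g x)"
proof (rule smooth_coinduct)
  let ?S = "{\<lambda>x. f x - c * g x |f g. smooth f \<and> smooth g}"
  show "(\<lambda>x. f x - c * g x) \<in> ?S" using assms by auto
  fix h assume "h \<in> ?S"
  then obtain f g where h: "h = (\<lambda>x. f x - c * g x)" and f: "smooth f" and g: "smooth g" by blast
  have "(h has_real_derivative deriv f x - c * deriv g x) (at x)" for x
    unfolding h by (auto intro!: derivative_eq_intros smooth_has_deriv f g)
  then show "\<exists>f'\<in>?S. \<forall>x. (h has_real_derivative f' x) (at x)"
    using smooth_deriv[OF f] smooth_deriv[OF g]
    by (intro bexI[of _ "\<lambda>x. deriv f x - c * deriv g x"]) auto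
qed

lemma smooth_antideriv:
  assumes "smooth f" "\<And>x. (F has_real_derivative f x) (at x)"
  shows "smooth F"
proof (rule smooth_coinduct[where S = "insert F {f. smooth f}"])
  fix h assume "h \<in> insert F {f. smooth f}"
  then show "\<exists>f'\<in>insert F {f. smooth f}. \<forall>x. (h has_real_derivative f' x) (at x)"
    using assms by (auto intro: smooth_has_deriv smooth_deriv)
qed simp

definition flat :: "real poly \<Rightarrow> real \<Rightarrow> real" where
  "flat p x = (if x > 0 then poly p (1 / x) * exp (- (1 / x)) else 0)"

lemma tendsto_poly_exp_minus: "((\<lambda>t. poly p t * exp (- t)) \<longlongrightarrow> (0::real)) at_top"
proof -
  have "((\<lambda>t. \<Sum>i\<le>degree p. coeff p i * (t ^ i / exp t)) \<longlongrightarrow> (\<Sum>i\<le>degree p. coeff p i * 0)) at_top"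
    by (intro tendsto_intros tendsto_power_div_exp_0)
  then show ?thesis
    by (simp add: poly_altdef sum_distrib_right exp_minus divide_inverse mult.assoc)
qed

lemma flat_deriv: "(flat p has_real_derivative flat ([:0, 0, 1:] * (p - pderiv p)) x) (at x)"
proof (cases x "0 :: real" rule: linorder_cases)
  case less
  have "((\<lambda>_. 0) has_real_derivative 0) (at x)" by simp
  then have "(flat p has_real_derivative 0) (at x)"
    by (rule has_field_derivative_transform_within_open[of _ _ _ "{..<0}"])
       (use less in \<open>auto simp: flat_def\<close>)
  then show ?thesis using less by (simp add: flat_def)
next
  case greater
  have "((\<lambda>x. poly p (1 / x) * exp (- (1 / x))) has_real_derivative
     flat ([:0, 0, 1:] * (p - pderiv p)) x) (at x)"
    using greater unfolding flat_def
    by (auto intro!: derivative_eq_intros DERIV_chain2[OF poly_DERIV] simp: field_simps power2_eq_square)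
  then show ?thesis
    by (rule has_field_derivative_transform_within_open[of _ _ _ "{0<..}"])
       (use greater in \<open>auto simp: flat_def\<close>)
next
  case equal
  have r: "((\<lambda>h. flat p h / h) \<longlongrightarrow> 0) (at_right 0)"
  proof -
    have "((\<lambda>h. poly (pCons 0 p) (1 / h) * exp (- (1 / h))) \<longlongrightarrow> 0) (at_right 0)"
      using filterlim_compose[OF tendsto_poly_exp_minus[of "pCons 0 p"] filterlim_inverse_at_top_right]
      by (simp add: divide_inverse)
    moreover have "eventually (\<lambda>h. poly (pCons 0 p) (1 / h) * exp (- (1 / h)) = flat p h / h) (at_right 0)"
      by (auto simp: eventually_at_right_field flat_def intro!: exI[of _ 1])
    ultimately show ?thesis by (rule Lim_transform_eventually)
  qed
  have l: "((\<lambda>h. flat p h / h) \<longlongrightarrow> 0) (at_left 0)"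
    by (rule Lim_transform_eventually[OF tendsto_const])
       (auto simp: eventually_at_left_field flat_def intro!: exI[of _ "-1"])
  have "((\<lambda>h. flat p h / h) \<longlongrightarrow> 0) (at 0)"
    using l r by (simp add: filterlim_split_at)
  then show ?thesis using equal by (simp add: DERIV_def flat_def)
qed

lemma smooth_flat: "smooth (flat p)"
  by (rule smooth_coinduct[where S = "range flat"]) (use flat_deriv in blast)+

section \<open>The fundamental lemma of the calculus of variations\<close>

lemma sigma_finite_lebesgue: "sigma_finite_measure (lebesgue :: real measure)"
proof
  have "(\<Union>n. {- real n..real n}) = UNIV"
    by (auto intro!: real_arch_simple[THEN ex_forward, of "\<bar>_\<bar>"] simp: abs_le_iff minus_le_iff)
  then show "\<exists>A::real set set. countable A \<and> A \<subseteq> sets lebesgue \<and> \<Union> A = space lebesgue \<and> (\<forall>a\<in>A. emeasure lebesgue a \<noteq> \<infinity>)"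
    by (intro exI[of _ "range (\<lambda>n::nat. {- real n..real n})"]) auto
qed

lemma integrable_AE_zero_of_lower_integrals:
  fixes f :: "real \<Rightarrow> complex"
  assumes f: "integrable lebesgue f" and supp: "\<And>x. x > b \<Longrightarrow> f x = 0"
    and z: "\<And>x. (LINT t:{..x}|lebesgue. f t) = 0"
  shows "AE x in lebesgue. f x = 0"
proof (rule sigma_finite_measure.density_zero[OF sigma_finite_lebesgue f])
  have si: "set_integrable lebesgue A f" if "A \<in> sets borel" for A
    unfolding set_integrable_def using that by (intro integrable_mult_indicator f) auto
  have borel: "(LINT t:A|lebesgue. f t) = 0" if "A \<in> sigma_sets UNIV (range atMost)" for A
    using _ _ that
  proof (rule sigma_sets_induct_disjoint)
    show "Int_stable (range (atMost :: real \<Rightarrow> real set))"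
      by (auto simp: Int_stable_def)
    have eq: "sigma_sets UNIV (range atMost) = sets (borel :: real measure)"
      by (simp add: borel_eq_atMost)
    show "(LINT t:A|lebesgue. f t) = 0" if "A \<in> range atMost" for A
      using z that by auto
    show "(LINT t:{}|lebesgue. f t) = 0" by (simp add: set_lebesgue_integral_def)
    show "(LINT t:UNIV - A|lebesgue. f t) = 0"
      if A: "A \<in> sigma_sets UNIV (range atMost)" "(LINT t:A|lebesgue. f t) = 0" for A
    proof -
      have "(LINT t:A \<union> (UNIV - A)|lebesgue. f t) = (LINT t:A|lebesgue. f t) + (LINT t:UNIV - A|lebesgue. f t)"
        using A by (intro set_integral_Un si) (auto simp: eq)
      moreover have "(LINT t:A \<union> (UNIV - A)|lebesgue. f t) = (LINT t:{..b}|lebesgue. f t)"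
        unfolding set_lebesgue_integral_def
        by (intro Bochner_Integration.integral_cong) (auto simp: indicator_def not_le supp)
      ultimately show ?thesis using A z by simp
    qed
    show "(LINT t:\<Union>(range A)|lebesgue. f t) = 0"
      if A: "disjoint_family A" "range A \<subseteq> sigma_sets UNIV (range atMost)"
        "\<And>i. (LINT t:A i|lebesgue. f t) = 0" for A :: "nat \<Rightarrow> real set"
    proof -
      have [measurable]: "A i \<in> sets borel" for i using A(2) eq by blast
      have "(LINT t:(\<Union>i. A i)|lebesgue. f t) = (\<Sum>i. (LINT t:(A i)|lebesgue. f t))"
        using A(1) by (intro lebesgue_integral_countable_add si) (auto simp: disjoint_family_on_def)
      with A(3) show ?thesis by simp
    qed
  qed simp
  fix A :: "real set" assume "A \<in> sets lebesgue"
  then obtain S N N' where A: "A = S \<union> N" "N \<subseteq> N'" "N' \<in> null_sets lborel" "S \<in> sets lborel"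
    by (auto elim!: sets_completionE)
  have "AE x in lebesgue. x \<notin> N'"
    using A by (intro AE_not_in null_sets_completionI)
  then have "AE x in lebesgue. x \<in> A \<longleftrightarrow> x \<in> S" by eventually_elim (use A in auto)
  then have "(LINT t:A|lebesgue. f t) = (LINT t:S|lebesgue. f t)"
    using \<open>A \<in> sets lebesgue\<close> A(4) f
    by (intro set_integral_cong_set)
       (auto simp: set_borel_measurable_def dest!: borel_measurable_integrable intro!: borel_measurable_scaleR borel_measurable_indicator)
  also have "\<dots> = 0" using A(4) by (intro borel) (simp add: borel_eq_atMost)
  finally show "(LINT t:A|lebesgue. f t) = 0" .
qed

lemma test_function_iff:
  "test_function \<phi> \<longleftrightarrow> smooth \<phi> \<and> (\<exists>a>0. \<exists>b. \<forall>x. x \<notin> {a..b} \<longrightarrow> \<phi> x = 0)"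
  by (simp add: test_function_def smooth_def)

definition bump :: "nat \<Rightarrow> real \<Rightarrow> real \<Rightarrow> real \<Rightarrow> real" where
  "bump n a b x = flat 1 (real (Suc n) * (x - a)) * flat 1 (real (Suc n) * (b - x))"

lemma smooth_bump: "smooth (bump n a b)"
proof -
  have "smooth (\<lambda>x. flat 1 (real (Suc n) * x + - (real (Suc n) * a)) * flat 1 ((- real (Suc n)) * x + real (Suc n) * b))"
    by (intro smooth_mult smooth_affine smooth_flat)
  moreover have "bump n a b = (\<lambda>x. flat 1 (real (Suc n) * x + - (real (Suc n) * a)) * flat 1 ((- real (Suc n)) * x + real (Suc n) * b))"
    by (auto simp: bump_def algebra_simps)
  ultimately show ?thesis by simp
qed

lemma flat_bounds: "0 \<le> flat 1 x" "flat 1 x \<le> 1"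
  by (auto simp: flat_def)

lemma flat_pos: "x > 0 \<Longrightarrow> flat 1 x > 0"
  by (simp add: flat_def)

lemma bump_bounds: "0 \<le> bump n a b x" "bump n a b x \<le> 1"
  using flat_bounds by (auto simp: bump_def intro: mult_le_one)

lemma bump_pos: "a < x \<Longrightarrow> x < b \<Longrightarrow> bump n a b x > 0"
  by (simp add: bump_def flat_pos)

lemma bump_eq_0: "x \<notin> {a<..<b} \<Longrightarrow> bump n a b x = 0"
  by (auto simp: bump_def flat_def zero_less_mult_iff)

lemma test_function_bump: "0 < a \<Longrightarrow> test_function (bump n a b)"
  unfolding test_function_iff using smooth_bump bump_eq_0
  by (meson atLeastAtMost_iff greaterThanLessThan_iff less_imp_le)

lemma bump_tendsto_indicator: "(\<lambda>n. bump n a b x) \<longlonglongrightarrow> indicator {a<..<b} x"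
proof (cases "x \<in> {a<..<b}")
  case True
  have f: "(\<lambda>n. flat 1 (real (Suc n) * c)) \<longlonglongrightarrow> 1" if "c > 0" for c
  proof -
    have "(\<lambda>n. exp (- (inverse c * inverse (real (Suc n))))) \<longlonglongrightarrow> exp (- (inverse c * 0))"
      by (intro tendsto_intros LIMSEQ_inverse_real_of_nat)
    with that show ?thesis by (simp add: flat_def divide_inverse mult.commute)
  qed
  have "(\<lambda>n. bump n a b x) \<longlonglongrightarrow> 1 * 1"
    unfolding bump_def using True by (intro tendsto_mult f) auto
  then show ?thesis using True by simp
qed (simp add: bump_eq_0)

lemma integral_half_line:
  fixes f :: "real \<Rightarrow> 'a::{banach, second_countable_topology}"
  assumes "a > 0" "\<And>x. x \<notin> {a..b} \<Longrightarrow> f x = 0"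
  shows "(LINT x|half_line. f x) = (LINT x|lebesgue. f x)"
  by (subst integral_restrict_space, simp, intro Bochner_Integration.integral_cong refl) (use assms in \<open>force simp: indicator_def\<close>)

lemma locally_integrable_indicator:
  assumes "locally_integrable g" "0 < a"
  shows "integrable lebesgue (\<lambda>x. indicator {a..b} x *\<^sub>R g x)"
  using assms integrable_restrict_space[of "{a..b}" lebesgue g]
  by (simp add: locally_integrable_def)

lemma AE_half_line_I:
  assumes "\<And>a b. 0 < a \<Longrightarrow> AE x in lebesgue. x \<in> {a..b} \<longrightarrow> P x"
  shows "AE x in half_line. P x"
proof -
  have "AE x in lebesgue. \<forall>n. x \<in> {1 / Suc n..real n} \<longrightarrow> P x"
    unfolding AE_all_countable by (intro allI assms) simp
  then have "AE x in lebesgue. x \<in> {0<..} \<longrightarrow> P x"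
  proof eventually_elim
    case (elim x)
    show ?case
    proof
      assume "x \<in> {0<..}"
      then obtain m where m: "inverse (real (Suc m)) < x" using reals_Archimedean by auto
      obtain k where k: "x \<le> real k" using real_arch_simple by blast
      let ?n = "max m k"
      have "1 / Suc ?n \<le> 1 / Suc m" by (intro divide_left_mono) auto
      also have "\<dots> \<le> x" using m by (simp add: divide_inverse)
      finally have "1 / Suc ?n \<le> x" .
      with k have "x \<in> {1 / Suc ?n..real ?n}" by auto
      with elim show "P x" by blast
    qed
  qed
  then show ?thesis by (simp add: AE_restrict_space_iff)
qed

lemma fundamental_lemma:
  assumes g: "locally_integrable g"
    and z: "\<And>\<phi>. test_function \<phi> \<Longrightarrow> (LINT x|half_line. \<phi> x *\<^sub>R g x) = 0"
  shows "AE x in half_line. g x = 0"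
proof (rule AE_half_line_I)
  fix a b :: real assume a: "0 < a"
  have int0: "(LINT t|lebesgue. indicator {a<..<c} t *\<^sub>R g t) = 0" for c
  proof -
    have gi: "integrable lebesgue (\<lambda>x. indicator {a..c} x *\<^sub>R g x)"
      by (rule locally_integrable_indicator[OF g a])
    have "(\<lambda>n. LINT t|lebesgue. bump n a c t *\<^sub>R (indicator {a..c} t *\<^sub>R g t))
        \<longlonglongrightarrow> (LINT t|lebesgue. indicator {a<..<c} t *\<^sub>R (indicator {a..c} t *\<^sub>R g t))"
    proof (rule integral_dominated_convergence)
      show "integrable lebesgue (\<lambda>x. norm (indicator {a..c} x *\<^sub>R g x))"
        using gi by (rule integrable_norm)
      have [measurable]: "bump n a c \<in> borel_measurable borel" for n
        using smooth_has_deriv[OF smooth_bump]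
        by (intro borel_measurable_continuous_onI DERIV_continuous_on) auto
      have [measurable]: "(\<lambda>x. indicator {a..c} x *\<^sub>R g x) \<in> borel_measurable lebesgue"
        using gi by auto
      have "bump n a c \<in> borel_measurable lebesgue" for n
        by (rule measurable_completion) simp
      then show "(\<lambda>x. bump n a c x *\<^sub>R (indicator {a..c} x *\<^sub>R g x)) \<in> borel_measurable lebesgue" for n
        by (intro borel_measurable_scaleR \<open>(\<lambda>x. indicator {a..c} x *\<^sub>R g x) \<in> borel_measurable lebesgue\<close>)
      show "AE x in lebesgue. norm (bump n a c x *\<^sub>R (indicator {a..c} x *\<^sub>R g x)) \<le> norm (indicator {a..c} x *\<^sub>R g x)" for n
        using bump_bounds by (intro AE_I2) (auto intro!: mult_left_le_one_le simp: indicator_def)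
      show "AE x in lebesgue. (\<lambda>n. bump n a c x *\<^sub>R indicator {a..c} x *\<^sub>R g x) \<longlonglongrightarrow>
          indicator {a<..<c} x *\<^sub>R indicator {a..c} x *\<^sub>R g x"
        by (intro AE_I2 tendsto_scaleR bump_tendsto_indicator tendsto_const)
      show "(\<lambda>x. indicator {a<..<c} x *\<^sub>R indicator {a..c} x *\<^sub>R g x) \<in> borel_measurable lebesgue"
        by (intro borel_measurable_scaleR borel_measurable_indicator
              \<open>(\<lambda>x. indicator {a..c} x *\<^sub>R g x) \<in> borel_measurable lebesgue\<close>) simp
    qed
    moreover have "(LINT t|lebesgue. bump n a c t *\<^sub>R (indicator {a..c} t *\<^sub>R g t)) = 0" for n
    proof -
      have "(LINT t|lebesgue. bump n a c t *\<^sub>R (indicator {a..c} t *\<^sub>R g t)) = (LINT t|lebesgue. bump n a c t *\<^sub>R g t)"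
        by (intro Bochner_Integration.integral_cong refl) (force simp: indicator_def intro: bump_eq_0)
      also have "\<dots> = (LINT t|half_line. bump n a c t *\<^sub>R g t)"
        by (rule integral_half_line[symmetric, where a=a and b=c]) (use a in \<open>auto simp: bump_eq_0\<close>)
      finally show ?thesis using z[OF test_function_bump[OF a]] by simp
    qed
    moreover have "(LINT t|lebesgue. indicator {a<..<c} t *\<^sub>R (indicator {a..c} t *\<^sub>R g t))
       = (LINT t|lebesgue. indicator {a<..<c} t *\<^sub>R g t)"
      by (intro Bochner_Integration.integral_cong refl) (auto simp: indicator_def)
    ultimately show ?thesis by (simp add: LIMSEQ_const_iff)
  qed
  have "AE x in lebesgue. indicator {a..b} x *\<^sub>R g x = 0"
  proof (rule integrable_AE_zero_of_lower_integrals)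
    show "integrable lebesgue (\<lambda>x. indicator {a..b} x *\<^sub>R g x)"
      by (rule locally_integrable_indicator[OF g a])
    show "indicator {a..b} x *\<^sub>R g x = 0" if "x > b" for x using that by simp
    fix x
    have gi: "set_integrable lebesgue {a..min b x} g"
      unfolding set_integrable_def by (rule locally_integrable_indicator[OF g a])
    have "AE t in lebesgue. t \<noteq> a \<and> t \<noteq> min b x"
      using AE_lborel_singleton by (intro AE_completion) auto
    then have "(LINT t:{..x}|lebesgue. indicator {a..b} t *\<^sub>R g t) = (LINT t|lebesgue. indicator {a<..<min b x} t *\<^sub>R g t)"
      unfolding set_lebesgue_integral_def
    proof (intro integral_cong_AE)
      show "(\<lambda>t. indicator {..x} t *\<^sub>R indicator {a..b} t *\<^sub>R g t) \<in> borel_measurable lebesgue"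
        by (intro borel_measurable_scaleR[OF borel_measurable_indicator]
              borel_measurable_integrable[OF locally_integrable_indicator[OF g a]]) simp
      have "set_integrable lebesgue {a<..<min b x} g"
        by (rule set_integrable_subset[OF gi]) auto
      then show "(\<lambda>t. indicator {a<..<min b x} t *\<^sub>R g t) \<in> borel_measurable lebesgue"
        unfolding set_integrable_def by auto
      show "AE t in lebesgue. indicator {..x} t *\<^sub>R indicator {a..b} t *\<^sub>R g t = indicator {a<..<min b x} t *\<^sub>R g t"
        if "AE t in lebesgue. t \<noteq> a \<and> t \<noteq> min b x"
        using that by eventually_elim (auto simp: indicator_def)
    qed
    with int0 show "(LINT t:{..x}|lebesgue. indicator {a..b} t *\<^sub>R g t) = 0" by simp
  qed
  then show "AE x in lebesgue. x \<in> {a..b} \<longrightarrow> g x = 0"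
    by eventually_elim auto
qed

section \<open>The lemma of du Bois-Reymond\<close>

lemma integrable_lebesgue_product:
  fixes \<psi> :: "real \<Rightarrow> real" and g :: "real \<Rightarrow> complex"
  assumes "integrable lebesgue \<psi>" "integrable lebesgue g"
  shows "integrable (lebesgue \<Otimes>\<^sub>M lebesgue) (\<lambda>(x, t). \<psi> x *\<^sub>R g t)"
proof -
  interpret pair_sigma_finite "lebesgue :: real measure" "lebesgue :: real measure"
    by (simp add: pair_sigma_finite_def sigma_finite_lebesgue)
  have [measurable]: "\<psi> \<in> borel_measurable lebesgue" "g \<in> borel_measurable lebesgue"
    using assms by auto
  show ?thesis
  proof (rule Fubini_integrable)
    show "(\<lambda>(x, t). \<psi> x *\<^sub>R g t) \<in> borel_measurable (lebesgue \<Otimes>\<^sub>M lebesgue)" by measurable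
  qed (use assms in auto)
qed

lemma Fubini_triangle:
  fixes \<psi> :: "real \<Rightarrow> real" and g :: "real \<Rightarrow> complex"
  assumes "integrable lebesgue \<psi>" "integrable lebesgue g"
  shows "(LINT x|lebesgue. \<psi> x *\<^sub>R (LINT t|lebesgue. indicator {..x} t *\<^sub>R g t)) =
         (LINT t|lebesgue. (LINT x|lebesgue. indicator {t..} x *\<^sub>R \<psi> x) *\<^sub>R g t)"
proof -
  interpret pair_sigma_finite "lebesgue :: real measure" "lebesgue :: real measure"
    by (simp add: pair_sigma_finite_def sigma_finite_lebesgue)
  have [measurable]: "(\<lambda>x. x) \<in> borel_measurable (lebesgue :: real measure)"
    using measurable_completion[of "\<lambda>x. x" "lborel :: real measure" borel] by simp
  have [measurable]: "\<psi> \<in> borel_measurable lebesgue" "g \<in> borel_measurable lebesgue"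
    using assms by auto
  have "(LINT x|lebesgue. \<psi> x *\<^sub>R (LINT t|lebesgue. indicator {..x} t *\<^sub>R g t)) =
      (LINT x|lebesgue. LINT t|lebesgue. (indicator {..x} t * \<psi> x) *\<^sub>R g t)"
    by (simp flip: integral_scaleR_right add: mult.commute)
  also have "\<dots> = (LINT t|lebesgue. LINT x|lebesgue. (indicator {..x} t * \<psi> x) *\<^sub>R g t)"
  proof (rule Fubini_integral[symmetric])
    have 1: "(\<lambda>p. (if snd p \<le> fst p then \<psi> (fst p) else 0) *\<^sub>R g (snd p)) \<in> borel_measurable (lebesgue \<Otimes>\<^sub>M lebesgue)"
      by measurable
    have 2: "(\<lambda>(x, t). (indicator {..x} t * \<psi> x) *\<^sub>R g t)
      = (\<lambda>p. (if snd p \<le> fst p then \<psi> (fst p) else 0) *\<^sub>R g (snd p))"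
      by (auto simp: fun_eq_iff indicator_def)
    show "integrable (lebesgue \<Otimes>\<^sub>M lebesgue) (\<lambda>(x, t). (indicator {..x} t * \<psi> x) *\<^sub>R g t)"
      unfolding 2
      by (rule Bochner_Integration.integrable_bound[OF integrable_lebesgue_product[OF assms] 1]) auto
  qed
  also have "\<dots> = (LINT t|lebesgue. (LINT x|lebesgue. indicator {t..} x *\<^sub>R \<psi> x) *\<^sub>R g t)"
  proof (intro Bochner_Integration.integral_cong refl)
    fix t
    have "integrable lebesgue (\<lambda>x. indicator {t..} x *\<^sub>R \<psi> x)"
      by (intro integrable_mult_indicator assms) simp
    then have "(LINT x|lebesgue. (indicator {t..} x *\<^sub>R \<psi> x) *\<^sub>R g t) = (LINT x|lebesgue. indicator {t..} x *\<^sub>R \<psi> x) *\<^sub>R g t"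
      by (intro integral_scaleR_left) simp
    moreover have "(LINT x|lebesgue. (indicator {..x} t * \<psi> x) *\<^sub>R g t) = (LINT x|lebesgue. (indicator {t..} x *\<^sub>R \<psi> x) *\<^sub>R g t)"
      by (intro Bochner_Integration.integral_cong refl) (auto simp: indicator_def)
    ultimately show "(LINT x|lebesgue. (indicator {..x} t * \<psi> x) *\<^sub>R g t) = (LINT x|lebesgue. indicator {t..} x *\<^sub>R \<psi> x) *\<^sub>R g t"
      by simp
  qed
  finally show ?thesis .
qed

lemma smooth_continuous: "smooth f \<Longrightarrow> continuous_on S f"
  by (meson DERIV_continuous_on has_field_derivative_at_within smooth_has_deriv)

lemma test_function_deriv:
  assumes "test_function \<phi>" shows "test_function (deriv \<phi>)"
proof -
  from assms obtain a b where ab: "a > 0" "\<And>x. x \<notin> {a..b} \<Longrightarrow> \<phi> x = 0" and s: "smooth \<phi>"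
    by (auto simp: test_function_iff)
  have "deriv \<phi> x = 0" if "x \<notin> {a..b}" for x
  proof -
    have "((\<lambda>_. 0) has_real_derivative 0) (at x)" by simp
    then have "(\<phi> has_real_derivative 0) (at x)"
      by (rule has_field_derivative_transform_within_open[of _ _ _ "- {a..b}"])
         (use ab that in auto)
    then show ?thesis by (rule DERIV_imp_deriv)
  qed
  with ab s show ?thesis by (auto simp: test_function_iff smooth_deriv)
qed

lemma test_function_funpow_deriv:
  assumes "test_function \<phi>" shows "test_function ((deriv ^^ k) \<phi>)"
  using deriv_funpow_in[of \<phi> "Collect test_function"] assms test_function_deriv by blast

lemma test_function_obtain_support:
  assumes "test_function \<phi>"
  obtains a b where "0 < a" "a \<le> b" "\<And>x. x \<notin> {a..b} \<Longrightarrow> \<phi> x = 0"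
proof -
  from assms obtain a b where "0 < a" "\<And>x. x \<notin> {a..b} \<Longrightarrow> \<phi> x = 0"
    by (auto simp: test_function_iff)
  then show ?thesis by (intro that[of a "max a b"]) (auto simp: max_def split: if_splits)
qed

lemma test_function_measurable: "test_function \<phi> \<Longrightarrow> \<phi> \<in> borel_measurable borel"
  by (intro borel_measurable_continuous_onI smooth_continuous) (simp add: test_function_iff)

lemma test_function_mult_integrable:
  assumes \<phi>: "test_function \<phi>" and g: "locally_integrable g"
  shows "integrable lebesgue (\<lambda>x. \<phi> x *\<^sub>R g x)" "integrable half_line (\<lambda>x. \<phi> x *\<^sub>R g x)"
proof -
  from \<phi> obtain a b where ab: "0 < a" "\<And>x. x \<notin> {a..b} \<Longrightarrow> \<phi> x = 0"
    using test_function_obtain_support by metis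
  have "continuous_on {a..b} \<phi>" using \<phi> by (simp add: smooth_continuous test_function_iff)
  then have "bounded (\<phi> ` {a..b})" by (intro compact_imp_bounded compact_continuous_image) auto
  then obtain B where B: "\<And>x. x \<in> {a..b} \<Longrightarrow> \<bar>\<phi> x\<bar> \<le> B"
    unfolding bounded_iff by force
  have gi: "integrable lebesgue (\<lambda>x. indicator {a..b} x *\<^sub>R g x)"
    by (rule locally_integrable_indicator[OF g ab(1)])
  have m: "\<phi> \<in> borel_measurable lebesgue"
    by (rule measurable_completion) (simp add: test_function_measurable[OF \<phi>])
  have eq: "(\<lambda>x. \<phi> x *\<^sub>R g x) = (\<lambda>x. \<phi> x *\<^sub>R (indicator {a..b} x *\<^sub>R g x))"
    using ab(2) by (force simp: indicator_def fun_eq_iff)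
  show i: "integrable lebesgue (\<lambda>x. \<phi> x *\<^sub>R g x)"
    unfolding eq
  proof (rule Bochner_Integration.integrable_bound)
    show "integrable lebesgue (\<lambda>x. B *\<^sub>R (indicator {a..b} x *\<^sub>R g x))"
      using gi by (intro integrable_scaleR_right) auto
    show "(\<lambda>x. \<phi> x *\<^sub>R (indicator {a..b} x *\<^sub>R g x)) \<in> borel_measurable lebesgue"
      by (intro borel_measurable_scaleR[OF m] borel_measurable_integrable[OF gi])
    show "AE x in lebesgue. norm (\<phi> x *\<^sub>R (indicator {a..b} x *\<^sub>R g x)) \<le> norm (B *\<^sub>R (indicator {a..b} x *\<^sub>R g x))"
      using B by (intro AE_I2) (force simp: indicator_def intro!: mult_right_mono)
  qed
  have "(\<lambda>x. indicator {0<..} x *\<^sub>R (\<phi> x *\<^sub>R g x)) = (\<lambda>x. \<phi> x *\<^sub>R g x)"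
    using ab by (force simp: indicator_def fun_eq_iff)
  with i show "integrable half_line (\<lambda>x. \<phi> x *\<^sub>R g x)"
    by (simp add: integrable_restrict_space)
qed

lemma continuous_on_imp_locally_integrable:
  assumes "continuous_on {0<..} (f :: real \<Rightarrow> complex)"
  shows "locally_integrable f"
  unfolding locally_integrable_def
proof (intro allI impI)
  fix a b :: real assume "0 < a"
  then have "continuous_on {a..b} f" by (intro continuous_on_subset[OF assms]) auto
  then have "set_integrable lebesgue {a..b} f" by (rule absolutely_integrable_continuous_real)
  then show "integrable (lebesgue_on {a..b}) f"
    by (simp add: integrable_restrict_space set_integrable_def)
qed

lemma locally_integrable_diff:
  "locally_integrable f \<Longrightarrow> locally_integrable g \<Longrightarrow> locally_integrable (\<lambda>x. f x - g x)"
  by (simp add: locally_integrable_def)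

lemma locally_integrable_add:
  "locally_integrable f \<Longrightarrow> locally_integrable g \<Longrightarrow> locally_integrable (\<lambda>x. f x + g x)"
  by (simp add: locally_integrable_def)

lemma locally_integrable_cmult:
  "locally_integrable f \<Longrightarrow> locally_integrable (\<lambda>x. c * f x)"
  by (simp add: locally_integrable_def)

lemma test_function_integrable:
  assumes "test_function \<phi>" shows "integrable lebesgue \<phi>"
proof -
  have "integrable lebesgue (\<lambda>x. \<phi> x *\<^sub>R (1::complex))"
    by (intro test_function_mult_integrable assms continuous_on_imp_locally_integrable) auto
  from integrable_Re[OF this] show ?thesis by simp
qed

lemma test_function_integral_half_line:
  fixes f :: "real \<Rightarrow> 'a :: {banach, second_countable_topology}"
  assumes "test_function \<phi>"
  shows "(LINT x|half_line. \<phi> x *\<^sub>R f x) = (LINT x|lebesgue. \<phi> x *\<^sub>R f x)"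
  using assms by (elim test_function_obtain_support) (rule integral_half_line, auto)

lemma test_function_tail_integral:
  assumes "test_function \<phi>"
  shows "(LINT x|lebesgue. indicator {t..} x *\<^sub>R deriv \<phi> x) = - \<phi> t"
proof -
  from assms obtain a b where ab: "0 < a" "a \<le> b" "\<And>x. x \<notin> {a..b} \<Longrightarrow> \<phi> x = 0"
    using test_function_obtain_support by metis
  have d0: "deriv \<phi> x = 0" if "x > b" for x
  proof -
    have "((\<lambda>_. 0) has_real_derivative 0) (at x)" by simp
    then have "(\<phi> has_real_derivative 0) (at x)"
      by (rule has_field_derivative_transform_within_open[of _ _ _ "{b<..}"])
         (use ab that in auto)
    then show ?thesis by (rule DERIV_imp_deriv)
  qed
  define c where "c = max b t + 1"
  have s: "smooth \<phi>" using assms by (simp add: test_function_iff)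
  have m: "(\<lambda>x. indicator {t..c} x *\<^sub>R deriv \<phi> x) \<in> borel_measurable borel"
    using smooth_continuous[OF smooth_deriv[OF s]]
    by (intro borel_measurable_scaleR borel_measurable_indicator borel_measurable_continuous_onI) auto
  have "(LINT x|lebesgue. indicator {t..} x *\<^sub>R deriv \<phi> x) = (LINT x|lebesgue. indicator {t..c} x *\<^sub>R deriv \<phi> x)"
    by (intro Bochner_Integration.integral_cong refl) (auto simp: indicator_def c_def d0)
  also have "\<dots> = (LINT x|lborel. indicator {t..c} x *\<^sub>R deriv \<phi> x)"
    using m by (intro integral_completion) simp
  also have "\<dots> = \<phi> c - \<phi> t"
  proof (rule integral_FTC_atLeastAtMost)
    show "(\<phi> has_vector_derivative deriv \<phi> x) (at x within {t..c})" for x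
      unfolding has_real_derivative_iff_has_vector_derivative[symmetric]
      by (rule has_field_derivative_at_within[OF smooth_has_deriv[OF s]])
  qed (auto simp: c_def smooth_continuous smooth_deriv s)
  also have "\<phi> c = 0" by (rule ab(3)) (auto simp: c_def)
  finally show ?thesis by simp
qed

lemma test_function_antideriv:
  assumes \<psi>: "test_function \<psi>" and 0: "(LINT x|lebesgue. \<psi> x) = 0"
  obtains \<phi> where "test_function \<phi>" "deriv \<phi> = \<psi>"
proof -
  from \<psi> obtain a b where ab: "0 < a" "a \<le> b" "\<And>x. x \<notin> {a..b} \<Longrightarrow> \<psi> x = 0"
    using test_function_obtain_support by metis
  define \<phi> where "\<phi> x = integral {0..x} \<psi>" for x
  have s: "smooth \<psi>" using \<psi> by (simp add: test_function_iff)
  have z: "\<phi> x = 0" if "x < a" for x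
  proof -
    have "\<phi> x = integral {0..x} (\<lambda>_. 0)"
      unfolding \<phi>_def using that by (intro Henstock_Kurzweil_Integration.integral_cong ab(3)) auto
    then show ?thesis by simp
  qed
  have d: "(\<phi> has_real_derivative \<psi> x) (at x)" for x
  proof (cases "x < a")
    case True
    have "((\<lambda>_. 0) has_real_derivative 0) (at x)" by simp
    then have "(\<phi> has_real_derivative 0) (at x)"
      by (rule has_field_derivative_transform_within_open[of _ _ _ "{..<a}"])
         (use z True in auto)
    with True ab(3) show ?thesis by simp
  next
    case False
    have "(\<phi> has_real_derivative \<psi> x) (at x within {0..x+1})"
      unfolding \<phi>_def
      by (rule integral_has_real_derivative) (use s False ab in \<open>auto intro: smooth_continuous\<close>)
    moreover have "at x within {0..x+1} = at x" using False ab by (intro at_within_interior) simp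
    ultimately show ?thesis by (simp only:)
  qed
  have "\<phi> x = 0" if "x > b" for x
  proof -
    have "set_integrable lebesgue {0..x} \<psi>"
      by (intro absolutely_integrable_continuous_real smooth_continuous s)
    then have "\<phi> x = (LINT t:{0..x}|lebesgue. \<psi> t)"
      unfolding \<phi>_def by (rule set_lebesgue_integral_eq_integral(2)[symmetric])
    also have "\<dots> = (LINT x|lebesgue. \<psi> x)"
      unfolding set_lebesgue_integral_def
      by (intro Bochner_Integration.integral_cong refl)
         (use ab(1) that in \<open>auto simp: indicator_def not_le intro!: ab(3)\<close>)
    finally show ?thesis using 0 by simp
  qed
  with z ab(1) have "\<exists>a>0. \<exists>b. \<forall>x. x \<notin> {a..b} \<longrightarrow> \<phi> x = 0"
    by (intro exI[of _ a]) (auto simp: not_le)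
  then have "test_function \<phi>"
    using smooth_antideriv[OF s d] by (simp add: test_function_iff)
  moreover have "deriv \<phi> = \<psi>" using d by (auto simp: DERIV_imp_deriv)
  ultimately show ?thesis by (rule that)
qed

lemma test_function_lincomb:
  assumes "test_function f" "test_function g"
  shows "test_function (\<lambda>x. f x - c * g x)"
proof -
  obtain a b where ab: "0 < a" "\<And>x. x \<notin> {a..b} \<Longrightarrow> f x = 0"
    using test_function_obtain_support[OF assms(1)] by metis
  obtain a' b' where ab': "0 < a'" "\<And>x. x \<notin> {a'..b'} \<Longrightarrow> g x = 0"
    using test_function_obtain_support[OF assms(2)] by metis
  have "f x - c * g x = 0" if "x \<notin> {min a a'..max b b'}" for x
    using ab(2)[of x] ab'(2)[of x] that by (auto simp: min_def max_def split: if_splits)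
  moreover have "min a a' > 0" using ab ab' by simp
  ultimately show ?thesis
    using smooth_lincomb[of f g c] assms unfolding test_function_iff by blast
qed

lemma unit_test_function:
  obtains \<rho> where "test_function \<rho>" "(LINT x|lebesgue. \<rho> x) \<noteq> 0"
proof (rule that[of "bump 0 1 2"])
  show t: "test_function (bump 0 1 2)" by (rule test_function_bump) simp
  show "(LINT x|lebesgue. bump 0 1 2 x) \<noteq> 0"
  proof
    assume "(LINT x|lebesgue. bump 0 1 2 x) = 0"
    then obtain \<phi> where \<phi>: "test_function \<phi>" "deriv \<phi> = bump 0 1 2"
      using test_function_antideriv[OF t] by blast
    have d: "(\<phi> has_real_derivative bump 0 1 2 x) (at x)" for x
      using smooth_has_deriv[of \<phi> x] \<phi> by (simp add: test_function_iff)
    obtain a b where ab: "0 < a" "a \<le> b" "\<And>x. x \<notin> {a..b} \<Longrightarrow> \<phi> x = 0"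
      using test_function_obtain_support[OF \<phi>(1)] by metis
    have "\<phi> 1 < \<phi> 2"
    proof (rule DERIV_pos_imp_increasing_open[where f=\<phi>])
      show "\<exists>y. (\<phi> has_real_derivative y) (at x) \<and> 0 < y" if "1 < x" "x < 2" for x
        using d[of x] bump_pos[OF that] by blast
      show "continuous_on {1..2} \<phi>"
        by (rule DERIV_continuous_on) (rule has_field_derivative_at_within[OF d])
    qed simp
    moreover have "\<phi> x \<le> \<phi> y" if "x \<le> y" for x y
      using DERIV_nonneg_imp_nondecreasing[where f = \<phi>, OF that] d bump_bounds(1) by blast
    then have "\<phi> 0 \<le> \<phi> 1" "\<phi> 2 \<le> \<phi> (max b 2 + 1)" by auto
    moreover have "\<phi> 0 = 0" "\<phi> (max b 2 + 1) = 0"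
      using ab(1) by (auto intro!: ab(3))
    ultimately show False by simp
  qed
qed

lemma du_Bois_Reymond_const:
  assumes v: "locally_integrable v"
    and z: "\<And>\<phi>. test_function \<phi> \<Longrightarrow> (LINT x|half_line. deriv \<phi> x *\<^sub>R v x) = 0"
  obtains C where "AE x in half_line. v x = C"
proof -
  obtain \<rho> where \<rho>: "test_function \<rho>" "(LINT x|lebesgue. \<rho> x) \<noteq> 0"
    by (rule unit_test_function)
  define C where "C = (LINT x|half_line. \<rho> x *\<^sub>R v x) / (LINT x|lebesgue. \<rho> x)"
  have "AE x in half_line. v x - C = 0"
  proof (rule fundamental_lemma)
    have lC: "locally_integrable (\<lambda>_. C)" by (intro continuous_on_imp_locally_integrable) auto
    show "locally_integrable (\<lambda>x. v x - C)" by (intro locally_integrable_diff v lC)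
    fix \<psi> assume \<psi>: "test_function \<psi>"
    define k where "k = (LINT x|lebesgue. \<psi> x) / (LINT x|lebesgue. \<rho> x)"
    have t: "test_function (\<lambda>x. \<psi> x - k * \<rho> x)" by (rule test_function_lincomb[OF \<psi> \<rho>(1)])
    have "(LINT x|lebesgue. \<psi> x - k * \<rho> x) = (LINT x|lebesgue. \<psi> x) - k * (LINT x|lebesgue. \<rho> x)"
      by (simp add: test_function_integrable \<psi> \<rho>)
    also have "\<dots> = 0" using \<rho> by (simp add: k_def)
    finally obtain \<phi> where \<phi>: "test_function \<phi>" "deriv \<phi> = (\<lambda>x. \<psi> x - k * \<rho> x)"
      using test_function_antideriv[OF t] by metis
    note i = test_function_mult_integrable(2)
    have k\<rho>: "integrable half_line (\<lambda>x. k *\<^sub>R (\<rho> x *\<^sub>R v x))"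
      using i[OF \<rho>(1) v] by (rule integrable_scaleR_right)
    have "0 = (LINT x|half_line. (\<psi> x - k * \<rho> x) *\<^sub>R v x)"
      using z[OF \<phi>(1)] \<phi>(2) by simp
    also have "\<dots> = (LINT x|half_line. \<psi> x *\<^sub>R v x - k *\<^sub>R (\<rho> x *\<^sub>R v x))"
      by (simp add: algebra_simps)
    also have "\<dots> = (LINT x|half_line. \<psi> x *\<^sub>R v x) - k *\<^sub>R (LINT x|half_line. \<rho> x *\<^sub>R v x)"
      unfolding Bochner_Integration.integral_diff[OF i[OF \<psi> v] k\<rho>] integral_scaleR_right ..
    finally have e: "(LINT x|half_line. \<psi> x *\<^sub>R v x) = k *\<^sub>R (LINT x|half_line. \<rho> x *\<^sub>R v x)" by simp
    have "(LINT x|half_line. \<psi> x *\<^sub>R C) = (LINT x|lebesgue. \<psi> x) *\<^sub>R C"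
      using test_function_integrable[OF \<psi>] by (simp add: test_function_integral_half_line[OF \<psi>])
    also have "\<dots> = k *\<^sub>R (LINT x|half_line. \<rho> x *\<^sub>R v x)"
      using \<rho> by (simp add: C_def k_def scaleR_conv_of_real)
    finally show "(LINT x|half_line. \<psi> x *\<^sub>R (v x - C)) = 0"
      using e i[OF \<psi> v] i[OF \<psi> lC] by (simp add: scaleR_diff_right)
  qed
  then show ?thesis by (intro that[of C]) simp
qed

lemma weak_deriv_primitive:
  assumes w: "has_weak_deriv 1 u g"
  obtains v where "AE x in half_line. u x = v x"
    "\<And>x y. 0 < x \<Longrightarrow> x \<le> y \<Longrightarrow> (g has_integral v y - v x) {x..y}"
    "continuous_on {0<..} v"
proof -
  from w have u: "locally_integrable u" and g: "locally_integrable g"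
    by (auto simp: has_weak_deriv_def)
  have gi: "g absolutely_integrable_on {a..b}" if "0 < a" for a b
    using locally_integrable_indicator[OF g that] by (simp add: set_integrable_def)
  then have gi': "g integrable_on {a..b}" if "0 < a" for a b
    using set_lebesgue_integral_eq_integral(1) that by blast
  define G where "G x = integral {1..x} g - integral {x..1} g" for x
  have G: "G y - G x = integral {x..y} g" if xy: "0 < x" "x \<le> y" for x y
  proof -
    consider "y \<le> 1" | "x \<le> 1" "1 \<le> y" | "1 \<le> x" by linarith
    then show ?thesis
    proof cases
      case 1
      have "integral {x..y} g + integral {y..1} g = integral {x..1} g"
        using xy 1 gi' by (intro Henstock_Kurzweil_Integration.integral_combine) auto
      moreover have "integral {1..x} g = 0" "integral {1..y} g = 0"
        using xy 1 by (cases "x = 1"; cases "y = 1"; simp)+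
      ultimately show ?thesis by (simp add: G_def algebra_simps)
    next
      case 2
      have "integral {x..1} g + integral {1..y} g = integral {x..y} g"
        using xy 2 gi' by (intro Henstock_Kurzweil_Integration.integral_combine) auto
      moreover have "integral {1..x} g = 0" "integral {y..1} g = 0"
        using xy 2 by (cases "x = 1"; cases "y = 1"; simp)+
      ultimately show ?thesis by (simp add: G_def algebra_simps)
    next
      case 3
      have "integral {1..x} g + integral {x..y} g = integral {1..y} g"
        using xy 3 gi' by (intro Henstock_Kurzweil_Integration.integral_combine) auto
      moreover have "integral {x..1} g = 0" "integral {y..1} g = 0"
        using xy 3 by (cases "x = 1"; cases "y = 1"; simp)+
      ultimately show ?thesis by (simp add: G_def algebra_simps)
    qed
  qed
  have cont: "continuous_on {0<..} G"
  proof (rule continuous_at_imp_continuous_on, rule ballI)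
    fix x :: real assume "x \<in> {0<..}"
    then have x: "x > 0" by simp
    have "continuous_on {x/2..x+1} (\<lambda>y. G (x/2) + integral {x/2..y} g)"
      using x by (intro continuous_intros indefinite_integral_continuous_1 gi') simp
    then have "continuous_on {x/2..x+1} G"
      by (rule continuous_on_eq) (use x in \<open>auto simp flip: G\<close>)
    then show "isCont G x"
      by (rule continuous_on_interior) (use x in auto)
  qed
  have lG: "locally_integrable G" by (rule continuous_on_imp_locally_integrable[OF cont])
  note i = test_function_mult_integrable
  have parts: "(LINT x|lebesgue. deriv \<phi> x *\<^sub>R G x) = - (LINT x|lebesgue. \<phi> x *\<^sub>R g x)" if \<phi>: "test_function \<phi>" for \<phi>
  proof -
    from test_function_deriv[OF \<phi>] obtain a b where ab: "0 < a" "\<And>x. x \<notin> {a..b} \<Longrightarrow> deriv \<phi> x = 0"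
      using test_function_obtain_support by metis
    from \<phi> obtain a' b' where ab': "0 < a'" "\<And>x. x \<notin> {a'..b'} \<Longrightarrow> \<phi> x = 0"
      using test_function_obtain_support by metis
    define c d where "c = min a a'" and "d = max b b'"
    have c: "c > 0" using ab ab' by (simp add: c_def)
    have supp: "deriv \<phi> x = 0" "\<phi> x = 0" if "x \<notin> {c..d}" for x
      using ab(2)[of x] ab'(2)[of x] that by (auto simp: c_def d_def min_def max_def split: if_splits)
    define \<gamma> where "\<gamma> t = indicator {c..d} t *\<^sub>R g t" for t
    have \<gamma>: "integrable lebesgue \<gamma>" unfolding \<gamma>_def by (rule locally_integrable_indicator[OF g c])
    note d\<phi> = test_function_integrable[OF test_function_deriv[OF \<phi>]]
    have Gx: "deriv \<phi> x *\<^sub>R G x = deriv \<phi> x *\<^sub>R G c + deriv \<phi> x *\<^sub>R (LINT t|lebesgue. indicator {..x} t *\<^sub>R \<gamma> t)" for x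
    proof (cases "x \<in> {c..d}")
      case True
      have "(LINT t|lebesgue. indicator {..x} t *\<^sub>R \<gamma> t) = (LINT t:{c..x}|lebesgue. g t)"
        unfolding \<gamma>_def set_lebesgue_integral_def
        using True by (intro Bochner_Integration.integral_cong refl) (auto simp: indicator_def)
      also have "\<dots> = integral {c..x} g"
        by (rule set_lebesgue_integral_eq_integral(2)[OF gi[OF c]])
      also have "\<dots> = G x - G c" using True c by (simp add: G)
      finally have "G x = G c + (LINT t|lebesgue. indicator {..x} t *\<^sub>R \<gamma> t)" by simp
      then show ?thesis by (simp only: scaleR_add_right)
    qed (use supp in simp)
    have "integrable lebesgue (\<lambda>x. deriv \<phi> x *\<^sub>R G x)"
      by (rule i(1)[OF test_function_deriv[OF \<phi>] lG])
    moreover have iGc: "integrable lebesgue (\<lambda>x. deriv \<phi> x *\<^sub>R G c)"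
      using d\<phi> by simp
    ultimately have "integrable lebesgue (\<lambda>x. deriv \<phi> x *\<^sub>R G x - deriv \<phi> x *\<^sub>R G c)"
      by (rule Bochner_Integration.integrable_diff)
    then have i2: "integrable lebesgue (\<lambda>x. deriv \<phi> x *\<^sub>R (LINT t|lebesgue. indicator {..x} t *\<^sub>R \<gamma> t))"
      by (simp add: Gx)
    have "(LINT x|lebesgue. deriv \<phi> x) = (LINT x|lebesgue. indicator {0..} x *\<^sub>R deriv \<phi> x)"
      by (intro Bochner_Integration.integral_cong refl) (use supp c in \<open>force simp: indicator_def\<close>)
    also have "\<dots> = 0"
      unfolding test_function_tail_integral[OF \<phi>] using supp c by simp
    finally have I0: "(LINT x|lebesgue. deriv \<phi> x) = 0" .
    have "(LINT x|lebesgue. deriv \<phi> x *\<^sub>R G x) =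
        (LINT x|lebesgue. deriv \<phi> x *\<^sub>R G c) +
        (LINT x|lebesgue. deriv \<phi> x *\<^sub>R (LINT t|lebesgue. indicator {..x} t *\<^sub>R \<gamma> t))"
      unfolding Gx by (rule Bochner_Integration.integral_add[OF iGc i2])
    also have "(LINT x|lebesgue. deriv \<phi> x *\<^sub>R G c) = 0" using d\<phi> I0 by simp
    also have "(LINT x|lebesgue. deriv \<phi> x *\<^sub>R (LINT t|lebesgue. indicator {..x} t *\<^sub>R \<gamma> t))
      = (LINT t|lebesgue. (- \<phi> t) *\<^sub>R \<gamma> t)"
      unfolding Fubini_triangle[OF d\<phi> \<gamma>] test_function_tail_integral[OF \<phi>] ..
    also have "\<dots> = (LINT t|lebesgue. - (\<phi> t *\<^sub>R g t))"
      by (intro Bochner_Integration.integral_cong refl) (use supp in \<open>auto simp: \<gamma>_def indicator_def\<close>)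
    finally show ?thesis by simp
  qed
  obtain C where C: "AE x in half_line. u x - G x = C"
  proof (rule du_Bois_Reymond_const[of "\<lambda>x. u x - G x"])
    show "locally_integrable (\<lambda>x. u x - G x)" by (intro locally_integrable_diff u lG)
    fix \<phi> assume \<phi>: "test_function \<phi>"
    note d = test_function_deriv[OF \<phi>]
    have "(LINT x|half_line. deriv \<phi> x *\<^sub>R (u x - G x)) =
        (LINT x|half_line. deriv \<phi> x *\<^sub>R u x) - (LINT x|half_line. deriv \<phi> x *\<^sub>R G x)"
      using i(2)[OF d u] i(2)[OF d lG] by (simp add: scaleR_diff_right)
    also have "(LINT x|half_line. deriv \<phi> x *\<^sub>R u x) = - (LINT x|half_line. \<phi> x *\<^sub>R g x)"
      using w \<phi> by (simp add: has_weak_deriv_def)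
    also have "(LINT x|half_line. deriv \<phi> x *\<^sub>R G x) = - (LINT x|half_line. \<phi> x *\<^sub>R g x)"
      using parts[OF \<phi>] by (simp add: test_function_integral_half_line d \<phi>)
    finally show "(LINT x|half_line. deriv \<phi> x *\<^sub>R (u x - G x)) = 0" by simp
  qed
  show ?thesis
  proof (rule that[of "\<lambda>x. C + G x"])
    show "AE x in half_line. u x = C + G x"
      using C by eventually_elim (simp add: algebra_simps)
    show "(g has_integral C + G y - (C + G x)) {x..y}" if "0 < x" "x \<le> y" for x y
      using gi'[OF that(1), of y] G[OF that] by (simp add: integrable_integral)
    show "continuous_on {0<..} (\<lambda>x. C + G x)" by (intro continuous_intros cont)
  qed
qed

section \<open>Regularity of eigenfunctions\<close>

lemma weak_deriv_unique:
  assumes g: "has_weak_deriv k u g" and h: "has_weak_deriv k u h"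
  shows "AE x in half_line. g x = h x"
proof -
  from g h have lg: "locally_integrable g" and lh: "locally_integrable h"
    by (auto simp: has_weak_deriv_def)
  have "AE x in half_line. g x - h x = 0"
  proof (rule fundamental_lemma)
    show "locally_integrable (\<lambda>x. g x - h x)" by (rule locally_integrable_diff[OF lg lh])
    fix \<phi> assume \<phi>: "test_function \<phi>"
    have "(- 1) ^ k * (LINT x|half_line. \<phi> x *\<^sub>R g x) = (- 1) ^ k * (LINT x|half_line. \<phi> x *\<^sub>R h x)"
      using g h \<phi> by (simp add: has_weak_deriv_def)
    then have "(LINT x|half_line. \<phi> x *\<^sub>R g x) = (LINT x|half_line. \<phi> x *\<^sub>R h x)"
      by simp
    then show "(LINT x|half_line. \<phi> x *\<^sub>R (g x - h x)) = 0"
      using test_function_mult_integrable(2)[OF \<phi> lg] test_function_mult_integrable(2)[OF \<phi> lh]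
      by (simp add: scaleR_diff_right)
  qed
  then show ?thesis by simp
qed

lemma weak_deriv_weak_deriv:
  assumes g: "has_weak_deriv j u g" and h: "has_weak_deriv (j + k) u h"
  shows "has_weak_deriv k g h"
  unfolding has_weak_deriv_def
proof (intro conjI allI impI)
  show "locally_integrable g" "locally_integrable h"
    using g h by (auto simp: has_weak_deriv_def)
  fix \<phi> assume \<phi>: "test_function \<phi>"
  let ?\<phi> = "(deriv ^^ k) \<phi>"
  have "(- 1) ^ j * (LINT x|half_line. ?\<phi> x *\<^sub>R g x) = (LINT x|half_line. (deriv ^^ j) ?\<phi> x *\<^sub>R u x)"
    using g test_function_funpow_deriv[OF \<phi>] by (simp add: has_weak_deriv_def)
  also have "\<dots> = (- 1) ^ (j + k) * (LINT x|half_line. \<phi> x *\<^sub>R h x)"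
    using h \<phi> by (simp add: has_weak_deriv_def funpow_add)
  finally show "(LINT x|half_line. ?\<phi> x *\<^sub>R g x) = (- 1) ^ k * (LINT x|half_line. \<phi> x *\<^sub>R h x)"
    by (simp add: power_add mult.assoc)
qed

lemma weak_deriv_lincomb:
  assumes g: "has_weak_deriv k u g" and h: "has_weak_deriv k v h"
  shows "has_weak_deriv k (\<lambda>x. c * u x + d * v x) (\<lambda>x. c * g x + d * h x)"
proof -
  from g h have l: "locally_integrable u" "locally_integrable g" "locally_integrable v" "locally_integrable h"
    by (auto simp: has_weak_deriv_def)
  have split: "(LINT x|half_line. \<phi> x *\<^sub>R (c * p x + d * q x)) =
      c * (LINT x|half_line. \<phi> x *\<^sub>R p x) + d * (LINT x|half_line. \<phi> x *\<^sub>R q x)"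
    if "test_function \<phi>" "locally_integrable p" "locally_integrable q" for \<phi> p q
  proof -
    have "(LINT x|half_line. \<phi> x *\<^sub>R (c * p x + d * q x)) =
        (LINT x|half_line. c * (\<phi> x *\<^sub>R p x) + d * (\<phi> x *\<^sub>R q x))"
      by (simp add: scaleR_add_right)
    also have "\<dots> = (LINT x|half_line. c * (\<phi> x *\<^sub>R p x)) + (LINT x|half_line. d * (\<phi> x *\<^sub>R q x))"
      by (intro Bochner_Integration.integral_add integrable_mult_right test_function_mult_integrable that)
    finally show ?thesis by (simp only: integral_mult_right_zero)
  qed
  show ?thesis
    unfolding has_weak_deriv_def
  proof (intro conjI allI impI)
    fix \<phi> assume \<phi>: "test_function \<phi>"
    show "(LINT x|half_line. (deriv ^^ k) \<phi> x *\<^sub>R (c * u x + d * v x)) =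
        (- 1) ^ k * (LINT x|half_line. \<phi> x *\<^sub>R (c * g x + d * h x))"
      unfolding split[OF test_function_funpow_deriv[OF \<phi>] l(1,3)] split[OF \<phi> l(2,4)]
      using g h \<phi> by (simp add: has_weak_deriv_def algebra_simps)
  qed (intro locally_integrable_add locally_integrable_cmult l)+
qed

lemma weak_deriv_classical:
  assumes w: "has_weak_deriv 1 u g" and gc: "AE x in half_line. g x = c x"
    and c: "continuous_on {0<..} c"
  obtains v where "AE x in half_line. u x = v x"
    "\<And>x. 0 < x \<Longrightarrow> (v has_vector_derivative c x) (at x)"
proof -
  obtain v where v: "AE x in half_line. u x = v x"
    "\<And>x y. 0 < x \<Longrightarrow> x \<le> y \<Longrightarrow> (g has_integral v y - v x) {x..y}"
    using weak_deriv_primitive[OF w] by metis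
  from gc have "AE x in lebesgue. x \<in> {0<..} \<longrightarrow> g x = c x"
    by (simp add: AE_restrict_space_iff)
  then obtain N where N: "N \<in> null_sets lebesgue" "{x. \<not> (x \<in> {0<..} \<longrightarrow> g x = c x)} \<subseteq> N"
    by (auto simp: eventually_ae_filter)
  have neg: "negligible N" using N(1) by (simp add: negligible_iff_null_sets)
  have int: "(c has_integral v y - v x) {x..y}" if "0 < x" "x \<le> y" for x y
  proof (rule has_integral_spike[OF neg _ v(2)[OF that]])
    fix t assume "t \<in> {x..y} - N"
    then have "g t = c t" using subsetD[OF N(2), of t] that by auto
    then show "c t = g t" by simp
  qed
  have "(v has_vector_derivative c x) (at x)" if x: "0 < x" for x
  proof -
    have "((\<lambda>y. integral {x/2..y} c) has_vector_derivative c x) (at x within {x/2..x+1})"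
      using x by (intro integral_has_vector_derivative continuous_on_subset[OF c]) auto
    then have "((\<lambda>y. v (x/2) + integral {x/2..y} c) has_vector_derivative 0 + c x) (at x within {x/2..x+1})"
      by (intro has_vector_derivative_add) auto
    then have "(v has_vector_derivative c x) (at x within {x/2..x+1})"
      unfolding add_0_left
    proof (rule has_vector_derivative_transform[rotated -1])
      show "x \<in> {x/2..x+1}" using x by simp
      show "v y = v (x/2) + integral {x/2..y} c" if "y \<in> {x/2..x+1}" for y
        using int[of "x/2" y] that x by (auto simp: integral_unique)
    qed
    moreover have "at x within {x/2..x+1} = at x" using x by (intro at_within_interior) simp
    ultimately show ?thesis by (simp only:)
  qed
  with v(1) show ?thesis by (rule that)
qed

lemma continuous_AE_imp_eq:
  fixes v w :: "real \<Rightarrow> complex"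
  assumes v: "continuous_on {0<..} v" and w: "continuous_on {0<..} w"
    and ae: "AE x in half_line. v x = w x" and x: "0 < x"
  shows "v x = w x"
proof -
  let ?C = "- ({0<..} \<inter> (\<lambda>x. v x - w x) -` (- {0}))"
  have "open ({0<..} \<inter> (\<lambda>x. v x - w x) -` (- {0}))"
    by (intro continuous_open_preimage continuous_intros v w)
  then have cl: "closed ?C" by (simp only: closed_Compl)
  have "x \<in> ?C"
  proof (rule mem_closed_if_AE_lebesgue_open[OF _ cl])
    show "AE x \<in> {0<..} in lebesgue. x \<in> ?C"
      using ae by (simp add: AE_restrict_space_iff)
  qed (use x in auto)
  with x show ?thesis by simp
qed

lemma vanishing_trace_tendsto:
  assumes "vanishing_trace u" and "AE x in half_line. u x = v x" and v: "continuous_on {0<..} v"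
  shows "(v \<longlongrightarrow> 0) (at_right 0)"
proof -
  from assms(1) obtain t where t: "continuous_on {0..} t" "AE x in half_line. t x = u x" "t 0 = 0"
    by (auto simp: vanishing_trace_def)
  from t(2) assms(2) have ae: "AE x in half_line. t x = v x" by eventually_elim simp
  have eq: "t x = v x" if "0 < x" for x
    by (rule continuous_AE_imp_eq[OF continuous_on_subset[OF t(1)] v ae that]) auto
  have "(t \<longlongrightarrow> t 0) (at 0 within {0..})"
    using t(1) by (simp add: continuous_on_def)
  then have "(t \<longlongrightarrow> 0) (at_right 0)"
    unfolding t(3) by (rule tendsto_within_subset) auto
  then show ?thesis
    by (rule Lim_transform_eventually) (auto simp: eventually_at_right_field eq intro!: exI[of _ 1])
qed

definition square_integrable :: "(real \<Rightarrow> complex) \<Rightarrow> bool" where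
  "square_integrable f \<longleftrightarrow> integrable half_line (\<lambda>x. (cmod (f x))\<^sup>2)"

lemma continuous_half_line_measurable:
  "continuous_on {0<..} f \<Longrightarrow> f \<in> borel_measurable half_line"
  for f :: "real \<Rightarrow> 'a :: euclidean_space"
  by (rule continuous_imp_measurable_on_sets_lebesgue) auto

lemma L2_AE_square_integrable:
  assumes "g \<in> L2" "AE x in half_line. g x = f x" "continuous_on {0<..} f"
  shows "square_integrable f"
proof -
  have [measurable]: "f \<in> borel_measurable half_line" "g \<in> borel_measurable half_line"
    using continuous_half_line_measurable assms by (auto simp: L2_def)
  have "integrable half_line (\<lambda>x. (cmod (g x))\<^sup>2)" using assms by (simp add: L2_def)
  moreover have "AE x in half_line. (cmod (g x))\<^sup>2 = (cmod (f x))\<^sup>2"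
    using assms(2) by eventually_elim simp
  ultimately show ?thesis
    unfolding square_integrable_def by (subst (asm) integrable_cong_AE) auto
qed

lemma has_vector_derivative_continuous_on_half_line:
  assumes "\<And>x. 0 < x \<Longrightarrow> (f has_vector_derivative f' x) (at x)"
  shows "continuous_on {0<..} f"
  using assms by (intro continuous_at_imp_continuous_on ballI)
    (auto intro: has_vector_derivative_continuous)

lemma has_weak_deriv_weak_deriv: "has_weak_deriv k u g \<Longrightarrow> has_weak_deriv k u (weak_deriv k u)"
  unfolding weak_deriv_def by (rule someI[where P = "has_weak_deriv k u"])

lemma eigenfunction_regularity:
  fixes V V'' :: "real \<Rightarrow> real"
  assumes u: "u \<in> domA" and eq: "AE x in half_line. opA a R V V'' u x = l * opB a u x"
    and V: "continuous_on {0<..} V" and V'': "continuous_on {0<..} V''"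
  obtains u0 u1 u2 u3 u4 where "AE x in half_line. u x = u0 x"
    "\<And>x. 0 < x \<Longrightarrow> (u0 has_vector_derivative u1 x) (at x)"
    "\<And>x. 0 < x \<Longrightarrow> (u1 has_vector_derivative u2 x) (at x)"
    "\<And>x. 0 < x \<Longrightarrow> (u2 has_vector_derivative u3 x) (at x)"
    "\<And>x. 0 < x \<Longrightarrow> (u3 has_vector_derivative u4 x) (at x)"
    "continuous_on {0<..} u4"
    "square_integrable u0" "square_integrable u1" "square_integrable u2"
    "square_integrable u3" "square_integrable u4"
    "(u0 \<longlongrightarrow> 0) (at_right 0)" "(u1 \<longlongrightarrow> 0) (at_right 0)"
    "\<And>x. 0 < x \<Longrightarrow> - (- u4 x + (complex_of_real a)\<^sup>2 * u2 x)
        + (complex_of_real a)\<^sup>2 * (- u2 x + (complex_of_real a)\<^sup>2 * u0 x)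
        + \<i> * complex_of_real (a * R) * (complex_of_real (V x) * (- u2 x + (complex_of_real a)\<^sup>2 * u0 x)
            + complex_of_real (V'' x) * u0 x)
      = l * (- u2 x + (complex_of_real a)\<^sup>2 * u0 x)"
proof -
  let ?a = "(complex_of_real a)\<^sup>2"
  have uL: "u \<in> L2" and ex: "\<And>k. k \<in> {1..4} \<Longrightarrow> \<exists>g\<in>L2. has_weak_deriv k u g"
    using u by (auto simp: domA_def H_def)
  obtain g1 where g1: "g1 \<in> L2" "has_weak_deriv 1 u g1" using ex[of 1] by auto
  obtain g2 where g2: "g2 \<in> L2" "has_weak_deriv 2 u g2" using ex[of 2] by auto
  obtain g3 where g3: "g3 \<in> L2" "has_weak_deriv 3 u g3" using ex[of 3] by auto
  obtain g4 where g4: "g4 \<in> L2" "has_weak_deriv 4 u g4" using ex[of 4] by auto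
  have d12: "has_weak_deriv 1 g1 g2"
    by (rule weak_deriv_weak_deriv[OF g1(2)]) (use g2(2) in \<open>simp add: numeral_2_eq_2\<close>)
  have d23: "has_weak_deriv 1 g2 g3"
    by (rule weak_deriv_weak_deriv[OF g2(2)]) (use g3(2) in simp)
  have d34: "has_weak_deriv 1 g3 g4"
    by (rule weak_deriv_weak_deriv[OF g3(2)]) (use g4(2) in simp)
  obtain u3 where u3: "AE x in half_line. g3 x = u3 x" "continuous_on {0<..} u3"
    using weak_deriv_primitive[OF d34] by metis
  obtain u2 where u2: "AE x in half_line. g2 x = u2 x" "\<And>x. 0 < x \<Longrightarrow> (u2 has_vector_derivative u3 x) (at x)"
    using weak_deriv_classical[OF d23 u3] by metis
  have c2: "continuous_on {0<..} u2" by (rule has_vector_derivative_continuous_on_half_line[OF u2(2)])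
  obtain u1 where u1: "AE x in half_line. g1 x = u1 x" "\<And>x. 0 < x \<Longrightarrow> (u1 has_vector_derivative u2 x) (at x)"
    using weak_deriv_classical[OF d12 u2(1) c2] by metis
  have c1: "continuous_on {0<..} u1" by (rule has_vector_derivative_continuous_on_half_line[OF u1(2)])
  obtain u0 where u0: "AE x in half_line. u x = u0 x" "\<And>x. 0 < x \<Longrightarrow> (u0 has_vector_derivative u1 x) (at x)"
    using weak_deriv_classical[OF g1(2) u1(1) c1] by metis
  have c0: "continuous_on {0<..} u0" by (rule has_vector_derivative_continuous_on_half_line[OF u0(2)])
  define w where "w x = - u2 x + ?a * u0 x" for x
  define u4 where "u4 x = ?a * u2 x - ?a * w x
     - \<i> * complex_of_real (a * R) * (complex_of_real (V x) * w x + complex_of_real (V'' x) * u0 x) + l * w x" for x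
  have c4: "continuous_on {0<..} u4"
    unfolding u4_def w_def by (intro continuous_intros c0 c2 V V'')
  have wd2: "has_weak_deriv 2 u (weak_deriv 2 u)" by (rule has_weak_deriv_weak_deriv[OF g2(2)])
  have ae2: "AE x in half_line. weak_deriv 2 u x = u2 x"
    using weak_deriv_unique[OF wd2 g2(2)] u2(1) by eventually_elim simp
  have "has_weak_deriv 2 (weak_deriv 2 u) g4"
    by (rule weak_deriv_weak_deriv[OF wd2]) (use g4(2) in simp)
  from weak_deriv_lincomb[OF this g2(2), of "-1" ?a]
  have wdB: "has_weak_deriv 2 (opB a u) (\<lambda>x. - g4 x + ?a * g2 x)"
    by (simp add: opB_def)
  have ae4: "AE x in half_line. g4 x = u4 x"
    using eq ae2 u2(1) u0(1) weak_deriv_unique[OF has_weak_deriv_weak_deriv[OF wdB] wdB]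
  proof eventually_elim
    case (elim x)
    have B: "opB a u x = w x" using elim by (simp add: opB_def w_def)
    have "- (- g4 x + ?a * u2 x) + ?a * w x
      + \<i> * complex_of_real (a * R) * (complex_of_real (V x) * w x + complex_of_real (V'' x) * u0 x) = l * w x"
      using elim(1) unfolding opA_def opB_def[of a "opB a u"] elim(5) B elim(3,4) by simp
    then show ?case unfolding u4_def by (simp add: algebra_simps)
  qed
  obtain v3 where v3: "AE x in half_line. g3 x = v3 x" "\<And>x. 0 < x \<Longrightarrow> (v3 has_vector_derivative u4 x) (at x)"
    using weak_deriv_classical[OF d34 ae4 c4] by metis
  have "AE x in half_line. v3 x = u3 x" using u3(1) v3(1) by eventually_elim simp
  then have v3eq: "v3 x = u3 x" if "0 < x" for x
    using continuous_AE_imp_eq[OF has_vector_derivative_continuous_on_half_line[OF v3(2)] u3(2)] that by blast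
  have d3: "(u3 has_vector_derivative u4 x) (at x)" if "0 < x" for x
    by (rule has_vector_derivative_transform_within_open[OF v3(2)[OF that], of "{0<..}"])
       (use that v3eq in auto)
  have tr: "vanishing_trace u" "vanishing_trace (weak_deriv 1 u)"
    using u by (auto simp: domA_def H20_def)
  have ae1: "AE x in half_line. weak_deriv 1 u x = u1 x"
    using weak_deriv_unique[OF has_weak_deriv_weak_deriv[OF g1(2)] g1(2)] u1(1) by eventually_elim simp
  show ?thesis
  proof (rule that[of u0 u1 u2 u3 u4])
    show "square_integrable u0" by (rule L2_AE_square_integrable[OF uL u0(1) c0])
    show "square_integrable u1" by (rule L2_AE_square_integrable[OF g1(1) u1(1) c1])
    show "square_integrable u2" by (rule L2_AE_square_integrable[OF g2(1) u2(1) c2])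
    show "square_integrable u3" by (rule L2_AE_square_integrable[OF g3(1) u3])
    show "square_integrable u4" by (rule L2_AE_square_integrable[OF g4(1) ae4 c4])
    show "(u0 \<longlongrightarrow> 0) (at_right 0)" by (rule vanishing_trace_tendsto[OF tr(1) u0(1) c0])
    show "(u1 \<longlongrightarrow> 0) (at_right 0)" by (rule vanishing_trace_tendsto[OF tr(2) ae1 c1])
    show "- (- u4 x + ?a * u2 x) + ?a * (- u2 x + ?a * u0 x)
        + \<i> * complex_of_real (a * R) * (complex_of_real (V x) * (- u2 x + ?a * u0 x)
            + complex_of_real (V'' x) * u0 x)
      = l * (- u2 x + ?a * u0 x)" for x
      unfolding u4_def w_def by (simp add: algebra_simps)
  qed (fact u0 u1 u2 d3 c4)+
qed

section \<open>Integration by parts on the half-line\<close>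

lemma square_integrable_lincomb:
  assumes f: "square_integrable f" "continuous_on {0<..} f" and g: "square_integrable g" "continuous_on {0<..} g"
  shows "square_integrable (\<lambda>x. c * f x + d * g x)"
  unfolding square_integrable_def
proof (rule Bochner_Integration.integrable_bound)
  show "integrable half_line (\<lambda>x. 2 * (cmod c)\<^sup>2 * (cmod (f x))\<^sup>2 + 2 * (cmod d)\<^sup>2 * (cmod (g x))\<^sup>2)"
    using f g unfolding square_integrable_def
    by (intro Bochner_Integration.integrable_add integrable_mult_right) auto
  show "(\<lambda>x. (cmod (c * f x + d * g x))\<^sup>2) \<in> borel_measurable half_line"
    by (intro continuous_half_line_measurable continuous_intros f g)
  have "(cmod (c * f x + d * g x))\<^sup>2 \<le> 2 * (cmod c)\<^sup>2 * (cmod (f x))\<^sup>2 + 2 * (cmod d)\<^sup>2 * (cmod (g x))\<^sup>2" for x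
  proof -
    have "(cmod (c * f x + d * g x))\<^sup>2 \<le> (cmod (c * f x) + cmod (d * g x))\<^sup>2"
      by (intro power_mono norm_triangle_ineq) simp
    also have "\<dots> \<le> 2 * (cmod (c * f x))\<^sup>2 + 2 * (cmod (d * g x))\<^sup>2"
      using sum_squares_bound[of "cmod (c * f x)" "cmod (d * g x)"] by (simp add: power2_sum)
    finally show ?thesis by (simp add: norm_mult power_mult_distrib)
  qed
  then show "AE x in half_line. norm ((cmod (c * f x + d * g x))\<^sup>2)
      \<le> norm (2 * (cmod c)\<^sup>2 * (cmod (f x))\<^sup>2 + 2 * (cmod d)\<^sup>2 * (cmod (g x))\<^sup>2)"
    by (intro AE_I2) simp
qed

lemma square_integrable_weighted_product:
  fixes b :: "real \<Rightarrow> real"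
  assumes f: "square_integrable f" "continuous_on {0<..} f" and g: "square_integrable g" "continuous_on {0<..} g"
    and b: "continuous_on {0<..} b" "\<And>x. 0 < x \<Longrightarrow> \<bar>b x\<bar> \<le> B"
  shows "integrable half_line (\<lambda>x. complex_of_real (b x) * (f x * cnj (g x)))"
proof (rule Bochner_Integration.integrable_bound)
  show "integrable half_line (\<lambda>x. B * ((cmod (f x))\<^sup>2 + (cmod (g x))\<^sup>2))"
    using f g unfolding square_integrable_def
    by (intro Bochner_Integration.integrable_add integrable_mult_right) auto
  show "(\<lambda>x. complex_of_real (b x) * (f x * cnj (g x))) \<in> borel_measurable half_line"
    by (intro continuous_half_line_measurable continuous_intros f g b)
  have "norm (complex_of_real (b x) * (f x * cnj (g x))) \<le> norm (B * ((cmod (f x))\<^sup>2 + (cmod (g x))\<^sup>2))"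
    if "0 < x" for x
  proof -
    have "cmod (f x) * cmod (g x) \<le> (cmod (f x))\<^sup>2 + (cmod (g x))\<^sup>2"
      using sum_squares_bound[of "cmod (f x)" "cmod (g x)"] mult_nonneg_nonneg[OF norm_ge_zero norm_ge_zero, of "f x" "g x"]
      by linarith
    then have "\<bar>b x\<bar> * (cmod (f x) * cmod (g x)) \<le> B * ((cmod (f x))\<^sup>2 + (cmod (g x))\<^sup>2)"
      using b(2)[OF that] by (intro mult_mono) auto
    then show ?thesis by (simp add: norm_mult)
  qed
  then show "AE x in half_line. norm (complex_of_real (b x) * (f x * cnj (g x))) \<le> norm (B * ((cmod (f x))\<^sup>2 + (cmod (g x))\<^sup>2))"
    by (intro AE_I2) simp
qed

lemmas square_integrable_product = square_integrable_weighted_product[where b = "\<lambda>_. 1" and B = 1, simplified]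

lemma bounded_near_zero:
  fixes f :: "real \<Rightarrow> complex"
  assumes d: "\<And>x. 0 < x \<Longrightarrow> (f has_vector_derivative f' x) (at x)"
    and c: "continuous_on {0<..} f'" and sq: "square_integrable f'"
  shows "Bfun f (at_right 0)"
proof -
  define K where "K = 1 + integral {0<..} (\<lambda>t. (cmod (f' t))\<^sup>2)"
  have K: "cmod (f x) \<le> cmod (f 1) + K" if x: "0 < x" "x < 1" for x
  proof -
    have cx: "continuous_on {x..1} f'" by (rule continuous_on_subset[OF c]) (use x in auto)
    have "(f' has_integral f 1 - f x) {x..1}"
      using x by (intro fundamental_theorem_of_calculus) (auto intro!: has_vector_derivative_at_within d)
    then have "cmod (f 1 - f x) = cmod (integral {x..1} f')" by (simp add: integral_unique)
    also have "\<dots> \<le> integral {x..1} (\<lambda>t. 1 + (cmod (f' t))\<^sup>2)"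
    proof (rule integral_norm_bound_integral)
      show "cmod (f' t) \<le> 1 + (cmod (f' t))\<^sup>2" for t
        using sum_squares_bound[of 1 "cmod (f' t)"] norm_ge_zero[of "f' t"]
        unfolding power_one mult_1_right by linarith
    qed (intro integrable_continuous_real continuous_intros cx)+
    also have "\<dots> = (1 - x) + integral {x..1} (\<lambda>t. (cmod (f' t))\<^sup>2)"
      using x by (subst Henstock_Kurzweil_Integration.integral_add)
        (auto intro!: integrable_continuous_real continuous_intros cx)
    also have "\<dots> \<le> K"
      unfolding K_def
    proof (intro add_mono integral_subset_le)
      show "(\<lambda>t. (cmod (f' t))\<^sup>2) integrable_on {0<..}"
        using sq by (intro integrable_on_lebesgue_on) (auto simp: square_integrable_def)
    qed (use x in \<open>auto intro!: integrable_continuous_real continuous_intros cx\<close>)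
    finally show ?thesis using norm_triangle_sub[of "f x" "f 1"] by (simp add: norm_minus_commute)
  qed
  show ?thesis
    unfolding Bfun_def
  proof (intro exI conjI)
    have "K \<ge> 1" unfolding K_def
      using sq by (simp add: Henstock_Kurzweil_Integration.integral_nonneg integrable_on_lebesgue_on square_integrable_def)
    then show "0 < cmod (f 1) + K" using norm_ge_zero[of "f 1"] by linarith
    show "\<forall>\<^sub>F x in at_right 0. cmod (f x) \<le> cmod (f 1) + K"
      using K by (auto simp: eventually_at_right_field intro!: exI[of _ 1])
  qed
qed

lemma integrable_limit_at_top_zero:
  fixes F :: "real \<Rightarrow> complex"
  assumes F: "integrable half_line F" and lim: "(F \<longlongrightarrow> L) at_top"
  shows "L = 0"
proof (rule ccontr)
  assume L: "L \<noteq> 0"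
  define e where "e = cmod L / 2"
  have e: "e > 0" using L by (simp add: e_def)
  have "\<forall>\<^sub>F x in at_top. e < cmod (F x)"
    using tendsto_norm[OF lim] L by (intro order_tendstoD) (auto simp: e_def)
  then obtain x0 where x0: "\<And>x. x \<ge> x0 \<Longrightarrow> e < cmod (F x)"
    by (auto simp: eventually_at_top_linorder)
  define y where "y = max x0 1"
  let ?I = "LINT x|lebesgue. indicator {0<..} x * cmod (F x)"
  have iF: "integrable lebesgue (\<lambda>x. indicator {0<..} x * cmod (F x))"
    using integrable_norm[OF F] by (simp add: integrable_restrict_space)
  have "e * real n \<le> ?I" for n
  proof -
    have "e * real n = (LINT x|lebesgue. e * indicator {y..y + real n} x)"
      by simp
    also have "\<dots> \<le> ?I"
    proof (rule integral_mono[OF _ iF])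
      show "integrable lebesgue (\<lambda>x. e * indicator {y..y + real n} x)"
        by (intro integrable_mult_right) auto
      show "e * indicator {y..y + real n} x \<le> indicator {0<..} x * cmod (F x)" for x
        using x0[of x] by (auto simp: indicator_def y_def)
    qed
    finally show ?thesis .
  qed
  moreover obtain n where "?I < real n * e" using reals_Archimedean3[OF e] by blast
  ultimately show False by (metis mult.commute not_less)
qed

lemma integral_derivative_zero:
  fixes F :: "real \<Rightarrow> complex"
  assumes d: "\<And>x. 0 < x \<Longrightarrow> (F has_vector_derivative F' x) (at x)"
    and c: "continuous_on {0<..} F'"
    and F: "integrable half_line F" and F': "integrable half_line F'"
    and lim0: "(F \<longlongrightarrow> 0) (at_right 0)"
  shows "has_bochner_integral half_line F' 0"
proof -
  have iF': "set_integrable lebesgue {0<..} F'"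
    using F' by (simp add: integrable_restrict_space set_integrable_def)
  have ftc: "(LINT x:{1..b}|lebesgue. F' x) = F b - F 1" if "1 \<le> b" for b
  proof -
    have "set_integrable lebesgue {1..b} F'"
      by (rule set_integrable_subset[OF iF']) auto
    moreover have "(F' has_integral F b - F 1) {1..b}"
      using that by (intro fundamental_theorem_of_calculus) (auto intro!: has_vector_derivative_at_within d)
    ultimately show ?thesis by (simp add: set_lebesgue_integral_eq_integral(2) integral_unique)
  qed
  have "((\<lambda>b. LINT x:{1..b}|lebesgue. F' x) \<longlongrightarrow> (LINT x:{1..}|lebesgue. F' x)) at_top"
    by (rule tendsto_set_lebesgue_integral_at_top) (auto intro: set_integrable_subset[OF iF'])
  then have "((\<lambda>b. F 1 + (LINT x:{1..b}|lebesgue. F' x)) \<longlongrightarrow> F 1 + (LINT x:{1..}|lebesgue. F' x)) at_top"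
    by (intro tendsto_intros)
  then have limF: "(F \<longlongrightarrow> F 1 + (LINT x:{1..}|lebesgue. F' x)) at_top"
    by (rule Lim_transform_eventually)
       (use ftc in \<open>auto simp: eventually_at_top_linorder intro!: exI[of _ 1]\<close>)
  then have limF0: "(F \<longlongrightarrow> 0) at_top"
    using integrable_limit_at_top_zero[OF F limF] by simp
  have m: "(\<lambda>x. indicator {0<..} x *\<^sub>R F' x) \<in> borel_measurable borel"
    using c by (intro borel_measurable_continuous_on_indicator) auto
  have ei: "einterval 0 \<infinity> = {0<..}" by (auto simp: einterval_def zero_ereal_def)
  have "(LBINT x=0..\<infinity>. F' x) = 0 - 0"
  proof (rule interval_integral_FTC_integrable)
    show "(F has_vector_derivative F' x) (at x)" if "0 < ereal x" for x
      using that d by (simp add: zero_ereal_def)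
    show "isCont F' x" if "0 < ereal x" for x
      using c that by (simp add: zero_ereal_def continuous_on_eq_continuous_at)
    show "set_integrable lborel (einterval 0 \<infinity>) F'"
      using iF' m by (simp add: ei set_integrable_def integrable_completion)
    show "((F \<circ> real_of_ereal) \<longlongrightarrow> 0) (at_right 0)"
      unfolding zero_ereal_def o_def using lim0 ereal_tendsto_simps1(2)[of F 0 0] by (simp add: o_def zero_ereal_def)
    show "((F \<circ> real_of_ereal) \<longlongrightarrow> 0) (at_left \<infinity>)"
      using limF0 by (simp add: ereal_tendsto_simps)
  qed simp
  then have "(LINT x|lborel. indicator {0<..} x *\<^sub>R F' x) = 0"
    by (simp add: interval_lebesgue_integral_def ei set_lebesgue_integral_def)
  then have "(LINT x|half_line. F' x) = 0"
    using m by (simp add: integral_restrict_space integral_completion)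
  with F' show ?thesis by (simp add: has_bochner_integral_iff)
qed

section \<open>Energy identities and the enclosure\<close>

lemma has_bochner_integral_complex_of_real:
  "has_bochner_integral M f x \<Longrightarrow> has_bochner_integral M (\<lambda>t. complex_of_real (f t)) (complex_of_real x)"
  by (simp add: has_bochner_integral_iff)

lemma integral_half_line_pos:
  fixes f :: "real \<Rightarrow> real"
  assumes "integrable half_line f" "continuous_on {0<..} f" "\<And>x. 0 < x \<Longrightarrow> 0 \<le> f x" "0 < y" "f y \<noteq> 0"
  shows "0 < (LINT x|half_line. f x)"
proof -
  have "0 \<le> (LINT x|half_line. f x)"
    by (rule Bochner_Integration.integral_nonneg) (use assms(3) in simp)
  moreover have "(LINT x|half_line. f x) \<noteq> 0"
  proof
    assume "(LINT x|half_line. f x) = 0"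
    then have "AE x in half_line. f x = 0"
      by (subst (asm) integral_nonneg_eq_0_iff_AE) (use assms(1,3) in auto)
    then have "AE x in half_line. complex_of_real (f x) = 0" by simp
    then have "complex_of_real (f y) = 0"
      by (intro continuous_AE_imp_eq[where w = "\<lambda>_. 0"] continuous_intros assms)
    with assms(5) show False by simp
  qed
  ultimately show ?thesis by linarith
qed

lemma energy_identities:
  fixes a R :: real and V V' V'' :: "real \<Rightarrow> real" and l :: complex
  assumes a: "a > 0"
    and dV: "\<And>x. 0 < x \<Longrightarrow> (V has_real_derivative V' x) (at x)"
    and dV': "\<And>x. 0 < x \<Longrightarrow> (V' has_real_derivative V'' x) (at x)"
    and cV'': "continuous_on {0<..} V''"
    and bV: "\<And>x. 0 < x \<Longrightarrow> Vmin \<le> V x \<and> V x \<le> Vmax"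
    and bV': "\<And>x. 0 < x \<Longrightarrow> \<bar>V' x\<bar> \<le> B'"
    and bV'': "\<And>x. 0 < x \<Longrightarrow> \<bar>V'' x\<bar> \<le> B''"
    and V''_nonpos: "\<And>x. 0 < x \<Longrightarrow> V'' x \<le> 0"
    and d0: "\<And>x. 0 < x \<Longrightarrow> (u0 has_vector_derivative u1 x) (at x)"
    and d1: "\<And>x. 0 < x \<Longrightarrow> (u1 has_vector_derivative u2 x) (at x)"
    and d2: "\<And>x. 0 < x \<Longrightarrow> (u2 has_vector_derivative u3 x) (at x)"
    and d3: "\<And>x. 0 < x \<Longrightarrow> (u3 has_vector_derivative u4 x) (at x)"
    and c4: "continuous_on {0<..} u4"
    and s0: "square_integrable u0" and s1: "square_integrable u1" and s2: "square_integrable u2"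
    and s3: "square_integrable u3" and s4: "square_integrable u4"
    and t0: "(u0 \<longlongrightarrow> 0) (at_right 0)" and t1: "(u1 \<longlongrightarrow> 0) (at_right 0)"
    and ode: "\<And>x. 0 < x \<Longrightarrow> - (- u4 x + (complex_of_real a)\<^sup>2 * u2 x)
        + (complex_of_real a)\<^sup>2 * (- u2 x + (complex_of_real a)\<^sup>2 * u0 x)
        + \<i> * complex_of_real (a * R) * (complex_of_real (V x) * (- u2 x + (complex_of_real a)\<^sup>2 * u0 x)
            + complex_of_real (V'' x) * u0 x)
      = l * (- u2 x + (complex_of_real a)\<^sup>2 * u0 x)"
    and nz: "0 < y" "u0 y \<noteq> 0"
  obtains W n P K J where "0 < n" "a\<^sup>2 * n \<le> W" "Vmin * n \<le> P" "P \<le> Vmax * n" "K \<le> 0"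
    "Re J = - K / 2" "2 * a * cmod J \<le> B' * n"
    "l * complex_of_real n = complex_of_real W
      + \<i> * complex_of_real (a * R) * (complex_of_real P + J + complex_of_real K)"
proof -
  define w where "w x = (-1) * u2 x + complex_of_real (a\<^sup>2) * u0 x" for x
  define w1 where "w1 x = (-1) * u3 x + complex_of_real (a\<^sup>2) * u1 x" for x
  define w2 where "w2 x = (-1) * u4 x + complex_of_real (a\<^sup>2) * u2 x" for x
  have c0: "continuous_on {0<..} u0" by (rule has_vector_derivative_continuous_on_half_line[OF d0])
  have c1: "continuous_on {0<..} u1" by (rule has_vector_derivative_continuous_on_half_line[OF d1])
  have c2: "continuous_on {0<..} u2" by (rule has_vector_derivative_continuous_on_half_line[OF d2])
  have c3: "continuous_on {0<..} u3" by (rule has_vector_derivative_continuous_on_half_line[OF d3])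
  have sw: "square_integrable w" "square_integrable w1" "square_integrable w2"
    unfolding w_def w1_def w2_def by (intro square_integrable_lincomb s0 s1 s2 s3 s4 c0 c1 c2 c3 c4)+
  have cw: "continuous_on {0<..} w" "continuous_on {0<..} w1" "continuous_on {0<..} w2"
    unfolding w_def w1_def w2_def by (intro continuous_intros c0 c1 c2 c3 c4)+
  have dw: "(w has_vector_derivative w1 x) (at x)" "(w1 has_vector_derivative w2 x) (at x)" if "0 < x" for x
    unfolding w_def w1_def w2_def
    by (intro has_vector_derivative_add has_vector_derivative_mult_right d0 d1 d2 d3 that)+
  have cV: "continuous_on {0<..} V" and cV': "continuous_on {0<..} V'"
    using dV dV' by (auto intro!: continuous_at_imp_continuous_on intro: DERIV_isCont)
  have abV: "\<bar>V x\<bar> \<le> \<bar>Vmin\<bar> + \<bar>Vmax\<bar>" if "0 < x" for x using bV[OF that] by auto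
  have dVc: "((\<lambda>x. complex_of_real (V x)) has_vector_derivative complex_of_real (V' x)) (at x)"
    "((\<lambda>x. complex_of_real (V' x)) has_vector_derivative complex_of_real (V'' x)) (at x)" if "0 < x" for x
    using dV[OF that] dV'[OF that]
    by (auto intro!: has_vector_derivative_of_real simp: has_real_derivative_iff_has_vector_derivative)
  have dcnj: "((\<lambda>x. cnj (f x)) has_vector_derivative cnj (f' x)) (at x)"
    if "(f has_vector_derivative f' x) (at x)" for f f' x
    using that by (rule has_vector_derivative_cnj)
  note dmult = has_vector_derivative_mult
  have wint: "integrable half_line (\<lambda>x. complex_of_real (V x) * (f x * cnj (g x)))"
    "integrable half_line (\<lambda>x. complex_of_real (V' x) * (f x * cnj (g x)))"
    "integrable half_line (\<lambda>x. complex_of_real (V'' x) * (f x * cnj (g x)))"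
    if "square_integrable f" "continuous_on {0<..} f" "square_integrable g" "continuous_on {0<..} g" for f g
    by (rule square_integrable_weighted_product[OF that cV abV], assumption,
        rule square_integrable_weighted_product[OF that cV' bV'], assumption,
        rule square_integrable_weighted_product[OF that cV'' bV''])
  note int = square_integrable_product
  have Bw: "Bfun w (at_right 0)" by (rule bounded_near_zero[OF dw(1) cw(2) sw(2)])
  have Bw1: "Bfun w1 (at_right 0)" by (rule bounded_near_zero[OF dw(2) cw(3) sw(3)])
  have BV: "Bfun (\<lambda>x. complex_of_real (V x)) (at_right 0)" "Bfun (\<lambda>x. complex_of_real (V' x)) (at_right 0)"
    by (rule BfunI[where K = "\<bar>Vmin\<bar> + \<bar>Vmax\<bar>"], use abV in \<open>auto simp: eventually_at_right_field intro!: exI[of _ 1]\<close>)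
       (rule BfunI[where K = B'], use bV' in \<open>auto simp: eventually_at_right_field intro!: exI[of _ 1]\<close>)
  have t0': "((\<lambda>x. cnj (u0 x)) \<longlongrightarrow> 0) (at_right 0)" and t1': "((\<lambda>x. cnj (u1 x)) \<longlongrightarrow> 0) (at_right 0)"
    using tendsto_cnj[OF t0] tendsto_cnj[OF t1] by simp_all
  have bdd_mult: "((\<lambda>x. f x * g x) \<longlongrightarrow> 0) (at_right 0)"
    if "Bfun f (at_right 0)" "(g \<longlongrightarrow> 0) (at_right 0)" for f g :: "real \<Rightarrow> complex"
    using bounded_bilinear.Bfun_prod_Zfun[OF bounded_bilinear_mult that(1)] that(2) by (simp add: tendsto_Zfun_iff)
  note csts = continuous_intros c0 c1 c2 c3 c4 cw cV cV' cV''

  have I1: "has_bochner_integral half_line (\<lambda>x. w2 x * cnj (u0 x) - w x * cnj (u2 x)) 0"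
  proof (rule integral_derivative_zero[where F = "\<lambda>x. w1 x * cnj (u0 x) - w x * cnj (u1 x)"])
    fix x :: real assume x: "0 < x"
    have "((\<lambda>x. w1 x * cnj (u0 x) - w x * cnj (u1 x)) has_vector_derivative
        (w1 x * cnj (u1 x) + w2 x * cnj (u0 x)) - (w x * cnj (u2 x) + w1 x * cnj (u1 x))) (at x)"
      by (intro has_vector_derivative_diff dmult dcnj dw d0 d1 x)
    then show "((\<lambda>x. w1 x * cnj (u0 x) - w x * cnj (u1 x)) has_vector_derivative
        w2 x * cnj (u0 x) - w x * cnj (u2 x)) (at x)" by (simp add: algebra_simps)
  next
    show "((\<lambda>x. w1 x * cnj (u0 x) - w x * cnj (u1 x)) \<longlongrightarrow> 0) (at_right 0)"
      using tendsto_diff[OF bdd_mult[OF Bw1 t0'] bdd_mult[OF Bw t1']] by simp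
  qed (intro csts Bochner_Integration.integrable_diff int sw s0 s1 s2)+

  have I2: "has_bochner_integral half_line (\<lambda>x. u2 x * cnj (u0 x) + u1 x * cnj (u1 x)) 0"
  proof (rule integral_derivative_zero[where F = "\<lambda>x. u1 x * cnj (u0 x)"])
    fix x :: real assume x: "0 < x"
    have "((\<lambda>x. u1 x * cnj (u0 x)) has_vector_derivative u1 x * cnj (u1 x) + u2 x * cnj (u0 x)) (at x)"
      by (intro dmult dcnj d0 d1 x)
    then show "((\<lambda>x. u1 x * cnj (u0 x)) has_vector_derivative u2 x * cnj (u0 x) + u1 x * cnj (u1 x)) (at x)"
      by (simp add: algebra_simps)
  next
    show "((\<lambda>x. u1 x * cnj (u0 x)) \<longlongrightarrow> 0) (at_right 0)"
      using tendsto_mult[OF t1 t0'] by simp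
  qed (intro csts Bochner_Integration.integrable_add int s0 s1 s2)+

  have I3: "has_bochner_integral half_line (\<lambda>x. complex_of_real (V' x) * (u1 x * cnj (u0 x))
      + (complex_of_real (V x) * (u2 x * cnj (u0 x)) + complex_of_real (V x) * (u1 x * cnj (u1 x)))) 0"
  proof (rule integral_derivative_zero[where F = "\<lambda>x. complex_of_real (V x) * (u1 x * cnj (u0 x))"])
    fix x :: real assume x: "0 < x"
    have "((\<lambda>x. complex_of_real (V x) * (u1 x * cnj (u0 x))) has_vector_derivative
        complex_of_real (V x) * (u1 x * cnj (u1 x) + u2 x * cnj (u0 x)) + complex_of_real (V' x) * (u1 x * cnj (u0 x))) (at x)"
      by (intro dmult dcnj d0 d1 dVc x)
    then show "((\<lambda>x. complex_of_real (V x) * (u1 x * cnj (u0 x))) has_vector_derivative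
        complex_of_real (V' x) * (u1 x * cnj (u0 x))
      + (complex_of_real (V x) * (u2 x * cnj (u0 x)) + complex_of_real (V x) * (u1 x * cnj (u1 x)))) (at x)"
      by (simp add: algebra_simps)
  next
    show "((\<lambda>x. complex_of_real (V x) * (u1 x * cnj (u0 x))) \<longlongrightarrow> 0) (at_right 0)"
      using bdd_mult[OF BV(1)] tendsto_mult[OF t1 t0'] by simp
  qed (intro csts Bochner_Integration.integrable_add wint s0 s1 s2)+

  have I4: "has_bochner_integral half_line (\<lambda>x. complex_of_real (V'' x) * (u0 x * cnj (u0 x))
      + (complex_of_real (V' x) * (u1 x * cnj (u0 x)) + complex_of_real (V' x) * (u0 x * cnj (u1 x)))) 0"
  proof (rule integral_derivative_zero[where F = "\<lambda>x. complex_of_real (V' x) * (u0 x * cnj (u0 x))"])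
    fix x :: real assume x: "0 < x"
    have "((\<lambda>x. complex_of_real (V' x) * (u0 x * cnj (u0 x))) has_vector_derivative
        complex_of_real (V' x) * (u0 x * cnj (u1 x) + u1 x * cnj (u0 x)) + complex_of_real (V'' x) * (u0 x * cnj (u0 x))) (at x)"
      by (intro dmult dcnj d0 d1 dVc x)
    then show "((\<lambda>x. complex_of_real (V' x) * (u0 x * cnj (u0 x))) has_vector_derivative
        complex_of_real (V'' x) * (u0 x * cnj (u0 x))
      + (complex_of_real (V' x) * (u1 x * cnj (u0 x)) + complex_of_real (V' x) * (u0 x * cnj (u1 x)))) (at x)"
      by (simp add: algebra_simps)
  next
    show "((\<lambda>x. complex_of_real (V' x) * (u0 x * cnj (u0 x))) \<longlongrightarrow> 0) (at_right 0)"
      using bdd_mult[OF BV(2)] tendsto_mult[OF t0 t0'] by simp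
  qed (intro csts Bochner_Integration.integrable_add wint s0 s1)+

  define N where "N x = (cmod (u1 x))\<^sup>2 + a\<^sup>2 * (cmod (u0 x))\<^sup>2" for x
  define n where "n = (LINT x|half_line. N x)"
  define W where "W = (LINT x|half_line. (cmod (w x))\<^sup>2)"
  define P where "P = (LINT x|half_line. V x * N x)"
  define K where "K = (LINT x|half_line. V'' x * (cmod (u0 x))\<^sup>2)"
  define J where "J = (LINT x|half_line. complex_of_real (V' x) * (u1 x * cnj (u0 x)))"
  have iN: "integrable half_line N"
    unfolding N_def using s0 s1 unfolding square_integrable_def by simp
  have cN: "continuous_on {0<..} N" unfolding N_def by (intro csts)
  have iVN: "integrable half_line (\<lambda>x. V x * N x)"
  proof -
    have "integrable half_line (\<lambda>x. Re (complex_of_real (V x) * (u1 x * cnj (u1 x))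
        + complex_of_real (a\<^sup>2) * (complex_of_real (V x) * (u0 x * cnj (u0 x)))))"
      by (intro integrable_Re Bochner_Integration.integrable_add integrable_mult_right
          wint s0 c0 s1 c1)
    then show ?thesis by (simp add: N_def algebra_simps flip: complex_norm_square of_real_power)
  qed
  have iK: "integrable half_line (\<lambda>x. V'' x * (cmod (u0 x))\<^sup>2)"
    using integrable_Re[OF wint(3)[OF s0 c0 s0 c0]]
    by (simp flip: complex_norm_square of_real_power)
  have iJ: "integrable half_line (\<lambda>x. complex_of_real (V' x) * (u1 x * cnj (u0 x)))"
    by (rule wint[OF s1 c1 s0 c0])
  have iW: "integrable half_line (\<lambda>x. (cmod (w x))\<^sup>2)" using sw by (simp add: square_integrable_def)
  have hn: "has_bochner_integral half_line (\<lambda>x. complex_of_real (N x)) (complex_of_real n)"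
    and hW: "has_bochner_integral half_line (\<lambda>x. complex_of_real ((cmod (w x))\<^sup>2)) (complex_of_real W)"
    and hP: "has_bochner_integral half_line (\<lambda>x. complex_of_real (V x * N x)) (complex_of_real P)"
    and hK: "has_bochner_integral half_line (\<lambda>x. complex_of_real (V'' x * (cmod (u0 x))\<^sup>2)) (complex_of_real K)"
    and hJ: "has_bochner_integral half_line (\<lambda>x. complex_of_real (V' x) * (u1 x * cnj (u0 x))) J"
    unfolding n_def W_def P_def K_def J_def
    by (intro has_bochner_integral_complex_of_real has_bochner_integral_integrable iN iW iVN iK iJ)+

  let ?k = "\<i> * complex_of_real (a * R)"
  have lhs: "has_bochner_integral half_line (\<lambda>x. (complex_of_real ((cmod (w x))\<^sup>2) - (w2 x * cnj (u0 x) - w x * cnj (u2 x)))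
      + ?k * (complex_of_real (V x * N x) - (complex_of_real (V' x) * (u1 x * cnj (u0 x))
        + (complex_of_real (V x) * (u2 x * cnj (u0 x)) + complex_of_real (V x) * (u1 x * cnj (u1 x))))
        + complex_of_real (V' x) * (u1 x * cnj (u0 x)) + complex_of_real (V'' x * (cmod (u0 x))\<^sup>2)))
      ((complex_of_real W - 0) + ?k * (complex_of_real P - 0 + J + complex_of_real K))"
    by (intro has_bochner_integral_add has_bochner_integral_diff has_bochner_integral_mult_right
        hW hP hK hJ I1 I3)
  have rhs: "has_bochner_integral half_line
      (\<lambda>x. l * (complex_of_real (N x) - (u2 x * cnj (u0 x) + u1 x * cnj (u1 x)))) (l * (complex_of_real n - 0))"
    by (intro has_bochner_integral_diff has_bochner_integral_mult_right hn I2)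
  have "has_bochner_integral half_line
      (\<lambda>x. l * (complex_of_real (N x) - (u2 x * cnj (u0 x) + u1 x * cnj (u1 x))))
      ((complex_of_real W - 0) + ?k * (complex_of_real P - 0 + J + complex_of_real K))"
  proof (subst has_bochner_integral_cong[OF refl _ refl])
    fix x assume "x \<in> space half_line"
    then have x: "0 < x" by simp
    have "- w2 x + complex_of_real (a\<^sup>2) * w x + ?k * (complex_of_real (V x) * w x + complex_of_real (V'' x) * u0 x) = l * w x"
      using ode[OF x] by (simp add: w_def w2_def)
    then have "l * w x * cnj (u0 x) = (- w2 x + complex_of_real (a\<^sup>2) * w x
        + ?k * (complex_of_real (V x) * w x + complex_of_real (V'' x) * u0 x)) * cnj (u0 x)" by simp
    moreover have "l * (complex_of_real (N x) - (u2 x * cnj (u0 x) + u1 x * cnj (u1 x))) = l * w x * cnj (u0 x)"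
      unfolding N_def w_def of_real_add of_real_mult complex_norm_square by (simp add: algebra_simps)
    moreover have "complex_of_real ((cmod (w x))\<^sup>2) + w x * cnj (u2 x) = complex_of_real (a\<^sup>2) * w x * cnj (u0 x)"
      unfolding complex_norm_square by (simp add: w_def algebra_simps)
    moreover have "complex_of_real (V x * N x) - complex_of_real (V x) * (u2 x * cnj (u0 x)) - complex_of_real (V x) * (u1 x * cnj (u1 x))
        = complex_of_real (V x) * w x * cnj (u0 x)"
      unfolding N_def w_def of_real_add of_real_mult complex_norm_square by (simp add: algebra_simps)
    moreover have "complex_of_real (V'' x * (cmod (u0 x))\<^sup>2) = complex_of_real (V'' x) * u0 x * cnj (u0 x)"
      unfolding of_real_mult complex_norm_square by simp
    ultimately show "l * (complex_of_real (N x) - (u2 x * cnj (u0 x) + u1 x * cnj (u1 x)))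
      = (complex_of_real ((cmod (w x))\<^sup>2) - (w2 x * cnj (u0 x) - w x * cnj (u2 x)))
      + ?k * (complex_of_real (V x * N x) - (complex_of_real (V' x) * (u1 x * cnj (u0 x))
        + (complex_of_real (V x) * (u2 x * cnj (u0 x)) + complex_of_real (V x) * (u1 x * cnj (u1 x))))
        + complex_of_real (V' x) * (u1 x * cnj (u0 x)) + complex_of_real (V'' x * (cmod (u0 x))\<^sup>2))"
      by algebra
  qed (rule lhs)
  with rhs have "l * (complex_of_real n - 0) = (complex_of_real W - 0) + ?k * (complex_of_real P - 0 + J + complex_of_real K)"
    by (rule has_bochner_integral_eq)
  then have main: "l * complex_of_real n = complex_of_real W + ?k * (complex_of_real P + J + complex_of_real K)"
    by simp

  have "has_bochner_integral half_line (\<lambda>x. complex_of_real (V'' x * (cmod (u0 x))\<^sup>2)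
      + (complex_of_real (V' x) * (u1 x * cnj (u0 x)) + cnj (complex_of_real (V' x) * (u1 x * cnj (u0 x)))))
      (complex_of_real K + (J + cnj J))"
    by (intro has_bochner_integral_add hK hJ has_bochner_integral_cnj)
  then have "has_bochner_integral half_line (\<lambda>x. complex_of_real (V'' x) * (u0 x * cnj (u0 x))
      + (complex_of_real (V' x) * (u1 x * cnj (u0 x)) + complex_of_real (V' x) * (u0 x * cnj (u1 x))))
      (complex_of_real K + (J + cnj J))"
    unfolding of_real_mult complex_norm_square by (simp add: mult.commute)
  from has_bochner_integral_eq[OF this I4] have "Re (complex_of_real K + (J + cnj J)) = 0" by simp
  then have ReJ: "Re J = - K / 2" by simp

  have K0: "K \<le> 0"
  proof -
    have "0 \<le> (LINT x|half_line. - (V'' x * (cmod (u0 x))\<^sup>2))"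
      by (rule Bochner_Integration.integral_nonneg) (use V''_nonpos in \<open>auto intro: mult_nonpos_nonneg\<close>)
    then show ?thesis by (simp add: K_def)
  qed
  have N0: "0 \<le> N x" for x by (simp add: N_def)
  have n0: "0 < n"
    unfolding n_def by (rule integral_half_line_pos[OF iN cN N0 nz(1)]) (use nz a in \<open>simp add: N_def add_nonneg_eq_0_iff\<close>)
  have P1: "Vmin * n \<le> P" and P2: "P \<le> Vmax * n"
  proof -
    have "(LINT x|half_line. Vmin * N x) \<le> P"
      unfolding P_def by (rule integral_mono) (use bV N0 iN iVN in \<open>auto intro!: mult_right_mono\<close>)
    then show "Vmin * n \<le> P" by (simp add: n_def)
    have "P \<le> (LINT x|half_line. Vmax * N x)"
      unfolding P_def by (rule integral_mono) (use bV N0 iN iVN in \<open>auto intro!: mult_right_mono\<close>)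
    then show "P \<le> Vmax * n" by (simp add: n_def)
  qed
  have J1: "2 * a * cmod J \<le> B' * n"
  proof -
    have "cmod (2 * a * J) = cmod (LINT x|half_line. complex_of_real (2 * a) * (complex_of_real (V' x) * (u1 x * cnj (u0 x))))"
      by (simp add: J_def)
    also have "\<dots> \<le> (LINT x|half_line. cmod (complex_of_real (2 * a) * (complex_of_real (V' x) * (u1 x * cnj (u0 x)))))"
      by (rule integral_norm_bound)
    also have "\<dots> \<le> (LINT x|half_line. B' * N x)"
    proof (rule integral_mono)
      show "integrable half_line (\<lambda>x. cmod (complex_of_real (2 * a) * (complex_of_real (V' x) * (u1 x * cnj (u0 x)))))"
        by (intro integrable_norm integrable_mult_right iJ)
      show "integrable half_line (\<lambda>x. B' * N x)" using iN by simp
      fix x assume "x \<in> space half_line"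
      then have x: "0 < x" by simp
      have "2 * (cmod (u1 x)) * (a * cmod (u0 x)) \<le> (cmod (u1 x))\<^sup>2 + (a * cmod (u0 x))\<^sup>2"
        by (rule sum_squares_bound)
      then have "\<bar>V' x\<bar> * (2 * (cmod (u1 x)) * (a * cmod (u0 x))) \<le> B' * N x"
        using bV'[OF x] a by (intro mult_mono) (auto simp: N_def power_mult_distrib)
      then show "cmod (complex_of_real (2 * a) * (complex_of_real (V' x) * (u1 x * cnj (u0 x)))) \<le> B' * N x"
        using a by (simp add: norm_mult mult_ac)
    qed
    finally show ?thesis using a by (simp add: n_def norm_mult)
  qed
  have W1: "a\<^sup>2 * n \<le> W"
  proof -
    have "has_bochner_integral half_line (\<lambda>x. complex_of_real (N x) - (u2 x * cnj (u0 x) + u1 x * cnj (u1 x))) (complex_of_real n - 0)"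
      by (intro has_bochner_integral_diff hn I2)
    moreover have "complex_of_real (N x) - (u2 x * cnj (u0 x) + u1 x * cnj (u1 x)) = w x * cnj (u0 x)" for x
      unfolding N_def w_def of_real_add of_real_mult complex_norm_square by (simp add: algebra_simps)
    ultimately have wn: "has_bochner_integral half_line (\<lambda>x. w x * cnj (u0 x)) (complex_of_real n)" by simp
    then have n_eq: "n = (LINT x|half_line. Re (w x * cnj (u0 x)))"
      and iwn: "integrable half_line (\<lambda>x. Re (w x * cnj (u0 x)))"
      using integral_Re[of half_line "\<lambda>x. w x * cnj (u0 x)"] integrable_Re[of half_line "\<lambda>x. w x * cnj (u0 x)"]
      unfolding has_bochner_integral_iff by simp_all
    have "2 * a\<^sup>2 * n = (LINT x|half_line. 2 * a\<^sup>2 * Re (w x * cnj (u0 x)))"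
      by (simp add: n_eq)
    also have "\<dots> \<le> (LINT x|half_line. (cmod (w x))\<^sup>2 + a\<^sup>2 * N x)"
    proof (rule integral_mono)
      show "integrable half_line (\<lambda>x. 2 * a\<^sup>2 * Re (w x * cnj (u0 x)))" using iwn by simp
      show "integrable half_line (\<lambda>x. (cmod (w x))\<^sup>2 + a\<^sup>2 * N x)" using iW iN by simp
      fix x
      have "2 * a\<^sup>2 * Re (w x * cnj (u0 x)) \<le> 2 * a\<^sup>2 * cmod (w x * cnj (u0 x))"
        by (intro mult_left_mono complex_Re_le_cmod) simp
      also have "\<dots> = 2 * cmod (w x) * (a\<^sup>2 * cmod (u0 x))" by (simp add: norm_mult)
      also have "\<dots> \<le> (cmod (w x))\<^sup>2 + (a\<^sup>2 * cmod (u0 x))\<^sup>2" by (rule sum_squares_bound)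
      also have "(a\<^sup>2 * cmod (u0 x))\<^sup>2 = a\<^sup>2 * (a\<^sup>2 * (cmod (u0 x))\<^sup>2)" by (simp add: power2_eq_square)
      also have "\<dots> \<le> a\<^sup>2 * N x" by (intro mult_left_mono) (auto simp: N_def)
      finally show "2 * a\<^sup>2 * Re (w x * cnj (u0 x)) \<le> (cmod (w x))\<^sup>2 + a\<^sup>2 * N x" by simp
    qed
    also have "\<dots> = W + a\<^sup>2 * n" using iW iN by (simp add: W_def n_def)
    finally show ?thesis by linarith
  qed
  from n0 W1 P1 P2 K0 ReJ J1 main show ?thesis by (rule that)
qed

lemma mem_enclosure:
  fixes a R n W P K B' :: real and J l :: complex
  assumes "a > 0" "R > 0" "0 < n" "a\<^sup>2 * n \<le> W" "Vmin * n \<le> P" "P \<le> Vmax * n" "K \<le> 0"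
    and ReJ: "Re J = - K / 2" and J: "2 * a * cmod J \<le> B' * n"
    and l: "l * complex_of_real n = complex_of_real W
      + \<i> * complex_of_real (a * R) * (complex_of_real P + J + complex_of_real K)"
  shows "l \<in> complex_of_real ` {a\<^sup>2..}
            + (\<i> * complex_of_real (a * R)) *o (complex_of_real ` {Vmin..Vmax})
            + complex_of_real (R / 2 * B') *o Delta_minus"
proof -
  define z where "z = \<i> * complex_of_real (a * R / n) * (J + complex_of_real K)"
  have "J + complex_of_real K = - cnj J" using ReJ by (simp add: complex_eq_iff)
  then have "cmod z = a * R / n * cmod J"
    using assms(1-3) by (simp add: z_def norm_mult norm_divide)
  also have "\<dots> = R / (2 * n) * (2 * a * cmod J)" by simp
  also have "\<dots> \<le> R / (2 * n) * (B' * n)" using assms(1-3) by (intro mult_left_mono J) auto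
  also have "\<dots> = R / 2 * B'" using assms(3) by simp
  finally have z: "cmod z \<le> R / 2 * B'" .
  have "Im z = a * R / n * (K / 2)" using ReJ by (simp add: z_def)
  also have "\<dots> \<le> 0" using assms by (intro mult_nonneg_nonpos) auto
  finally have Imz: "Im z \<le> 0" .
  have mem: "z \<in> complex_of_real (R / 2 * B') *o Delta_minus"
  proof (cases "R / 2 * B' = 0")
    case True
    with z have "cmod z \<le> 0" by (simp only:)
    then have "z = 0" by simp
    moreover have "0 \<in> Delta_minus" by (simp add: Delta_minus_def Delta_def)
    ultimately show ?thesis using True unfolding elt_set_times_def by force
  next
    case False
    define r where "r = R / 2 * B'"
    have r: "0 < r" "cmod z \<le> r"
      using z False norm_ge_zero[of z] unfolding r_def by linarith+
    have "z / complex_of_real r \<in> Delta_minus"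
      using r Imz unfolding Delta_minus_def Delta_def
      by (simp add: norm_divide divide_le_eq Im_divide_of_real divide_nonpos_pos)
    moreover have "z = complex_of_real r * (z / complex_of_real r)" using r by simp
    ultimately show ?thesis unfolding elt_set_times_def r_def by blast
  qed
  have "l = complex_of_real (W / n) + \<i> * complex_of_real (a * R) * complex_of_real (P / n) + z"
  proof -
    have "l = (complex_of_real W
      + \<i> * complex_of_real (a * R) * (complex_of_real P + J + complex_of_real K)) / complex_of_real n"
      unfolding l[symmetric] using assms(3) by simp
    also have "\<dots> = complex_of_real (W / n) + \<i> * complex_of_real (a * R) * complex_of_real (P / n) + z"
      unfolding z_def by (simp add: add_divide_distrib distrib_left)
    finally show ?thesis .
  qed
  moreover have "complex_of_real (W / n) \<in> complex_of_real ` {a\<^sup>2..}"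
    using assms by (intro imageI) (simp add: le_divide_eq)
  moreover have "\<i> * complex_of_real (a * R) * complex_of_real (P / n) \<in>
      (\<i> * complex_of_real (a * R)) *o (complex_of_real ` {Vmin..Vmax})"
    using assms by (intro set_times_intro2 imageI) (simp add: le_divide_eq divide_le_eq)
  ultimately show ?thesis using mem by (metis set_plus_intro)
qed

theorem theorem3p3:
  fixes a R :: real and V V' V'' :: "real \<Rightarrow> real"
    and Vmin Vmax V'absmax V''min V''max :: real
    and l :: complex
  assumes "a > 0" and "R > 0"
    and "\<And>x. x \<ge> 0 \<Longrightarrow> (V has_real_derivative V' x) (at x within {0..})"
    and "\<And>x. x \<ge> 0 \<Longrightarrow> (V' has_real_derivative V'' x) (at x within {0..})"
    and "continuous_on {0..} V''"
    and "\<And>x. x \<ge> 0 \<Longrightarrow> Vmin \<le> V x \<and> V x \<le> Vmax"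
    and "\<And>x. x \<ge> 0 \<Longrightarrow> \<bar>V' x\<bar> \<le> V'absmax"
    and "\<And>x. x \<ge> 0 \<Longrightarrow> V''min \<le> V'' x \<and> V'' x \<le> V''max"
    and "\<And>x. x \<ge> 0 \<Longrightarrow> V'' x \<le> 0"
    and "pencil_eigenvalue domA (opA a R V V'') (opB a) l"
  shows "l \<in> complex_of_real ` {a\<^sup>2..}
            + (\<i> * complex_of_real (a * R)) *o (complex_of_real ` {Vmin..Vmax})
            + complex_of_real (R / 2 * V'absmax) *o Delta_minus"
proof -
  have at: "at x within {0..} = at x" if "0 < x" for x :: real
    using that by (intro at_within_interior) simp
  have dV: "(V has_real_derivative V' x) (at x)" "(V' has_real_derivative V'' x) (at x)" if "0 < x" for x
    using assms(3)[of x] assms(4)[of x] that by (auto simp only: at less_imp_le)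
  have cV'': "continuous_on {0<..} V''" by (rule continuous_on_subset[OF assms(5)]) auto
  have cV: "continuous_on {0<..} V"
    using dV by (auto intro!: continuous_at_imp_continuous_on intro: DERIV_isCont)
  from assms(10) obtain u where u: "u \<in> domA" "\<not> (AE x in half_line. u x = 0)"
    "AE x in half_line. opA a R V V'' u x = l * opB a u x"
    by (auto simp: pencil_eigenvalue_def)
  from u(1,3) cV cV'' show ?thesis
  proof (rule eigenfunction_regularity)
    fix u0 u1 u2 u3 u4
    assume u0: "AE x in half_line. u x = u0 x"
    assume *: "\<And>x. 0 < x \<Longrightarrow> (u0 has_vector_derivative u1 x) (at x)"
      "\<And>x. 0 < x \<Longrightarrow> (u1 has_vector_derivative u2 x) (at x)"
      "\<And>x. 0 < x \<Longrightarrow> (u2 has_vector_derivative u3 x) (at x)"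
      "\<And>x. 0 < x \<Longrightarrow> (u3 has_vector_derivative u4 x) (at x)"
      "continuous_on {0<..} u4"
      "square_integrable u0" "square_integrable u1" "square_integrable u2"
      "square_integrable u3" "square_integrable u4"
      "(u0 \<longlongrightarrow> 0) (at_right 0)" "(u1 \<longlongrightarrow> 0) (at_right 0)"
      "\<And>x. 0 < x \<Longrightarrow> - (- u4 x + (complex_of_real a)\<^sup>2 * u2 x)
        + (complex_of_real a)\<^sup>2 * (- u2 x + (complex_of_real a)\<^sup>2 * u0 x)
        + \<i> * complex_of_real (a * R) * (complex_of_real (V x) * (- u2 x + (complex_of_real a)\<^sup>2 * u0 x)
            + complex_of_real (V'' x) * u0 x)
      = l * (- u2 x + (complex_of_real a)\<^sup>2 * u0 x)"
    have "\<exists>y>0. u0 y \<noteq> 0"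
    proof (rule ccontr)
      assume "\<not> (\<exists>y>0. u0 y \<noteq> 0)"
      then have "AE x in half_line. u0 x = 0" by (intro AE_I2) auto
      with u0 have "AE x in half_line. u x = 0" by eventually_elim simp
      with u(2) show False by blast
    qed
    then obtain y where y: "0 < y" "u0 y \<noteq> 0" by blast
    have b: "Vmin \<le> V x \<and> V x \<le> Vmax" "\<bar>V' x\<bar> \<le> V'absmax" "\<bar>V'' x\<bar> \<le> \<bar>V''min\<bar> + \<bar>V''max\<bar>" "V'' x \<le> 0"
      if "0 < x" for x
      using assms(6-9)[of x] that by auto
    show ?thesis
      by (rule energy_identities[OF assms(1) dV cV'' b * y];
          (assumption | (rule mem_enclosure[OF assms(1,2)]; assumption)))
  qed
qed

end
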